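(* Let $t$ be a fixed integer, $a,b$ reals with $0<b\le a^t<1$, $R=R(m)$ an $(a,b)$-plastic set of size $t$ with respect to $m$ (with $m$ sufficiently large), and $U$ a non-monotonic $k$-permutation sequence of $R$ with $k>3$; let $\tau=\tau(U)$. Define $\theta_1:=\lfloor 2^{\log^a(\min U)}\rfloor$ and $\theta_{j+1}:=\lfloor 2^{\log^a\theta_j}\rfloor$ for $j\in[\tau-1]$. Then one can generate a string of arrays $\mathcal A(U)=\mathcal A_{[0]},\mathcal A_{[1]},\ldots,\mathcal A_{[\tau]}$ such that for each $i\in[\tau]$: (1) $\mathcal A_{[i]}$ can be taken to be either type of ancestor of $\mathcal A_{[i-1]}$ by $\theta_i$ (both exist); (2) $\theta_1,\ldots,\theta_i$ all occur as coefficients of $\mathcal A_{[i]}$ (possibly in different sides); (3) $\mathcal A_{[i]}\setminus\{\theta_1,\ldots,\theta_i\}\ \overset{\theta_1}{\approx}\ \mathcal A(U^{(i)})$, where the left side is obtained by removing one occurrence of each $\theta_j$, $j\le i$, from the side containing it; (4) $\mathcal A_{[i]}$ is $(a,ba^{i})$-feasible with respect to $m$.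
   Context: Logarithms base $2$, asymptotics as $m\to\infty$. $R=R(m)=\{b_1,\ldots,b_t\}\subseteq[m]$ is $(a,b)$-plastic w.r.t. $m$ if $\log b_1=\Omega(\log^b m)$, $\log b_t=O(\log^a m)$, $\log b_i=O(\log^a b_{i+1})$ for $i\in[t-1]$. A $k$-permutation sequence of $R$ is a sequence $U=(u_1,\ldots,u_k)$ of distinct elements of $R$, regarded cyclically; it is monotonic if some cyclic shift is increasing or decreasing. $U'$ deletes $\max U$ keeping the order of the rest; $U^{(0)}=U$, $U^{(j+1)}=(U^{(j)})'$; $\tau(U)$ is the least $j\ge0$ with $U^{(j)}$ monotonic. $\mathcal L(U)$: $(u_1-u_k)x_1+(u_2-u_1)x_2+\cdots+(u_k-u_{k-1})x_k=0$; its array $\mathcal A(U)=(\mathcal A_+;\mathcal A_-)$ has $\mathcal A_+$ the multiset of positive coefficients and $\mathcal A_-$ the multiset of absolute values of negative ones. A general array is such a pair of multisets of positive integers, representing $\sum_{\mathcal A_+}a x_a=\sum_{\mathcal A_-}a' y_{a'}$; its type is $(|\mathcal A_+|,|\mathcal A_-|)$; it is invariant if both sides have equal sum. For $0<a,b'<1$, an invariant array $\mathcal A(m)$ is $(a,b')$-feasible w.r.t. $m$ if for large $m$: its entries are mutually distinct; with $\alpha=\max\mathcal A_+$, $\alpha'=\max\mathcal A_-$, $|\alpha'-\alpha|=o(\alpha)$ and $\log\alpha=O(\log^a m)$; and each $w\in Z(\mathcal A):=\mathcal A_+\cup\mathcal A_-\cup\{|\alpha-\alpha'|\}\setminus\{\alpha,\alpha'\}$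 has $\Omega(\log^{b'}m)=\log w=O(\log^a\alpha)$. Ancestors by $\theta$ (for $\theta$ with $\theta\to\infty$, $\theta=O(2^{\log^a\delta})$, $\delta=\min(\mathcal A_+\cup\mathcal A_-\cup\{|v-w|:v\ne w\in\mathcal A\})$, of a feasible array with both sides of size $\ge2$): if $\alpha'>\alpha$, first type $(\mathcal A_+\setminus\{\alpha\};\mathcal A_-\setminus\{\alpha'\}\cup\{\alpha'-\alpha-\theta,\theta\})$, second type $(\mathcal A_+\setminus\{\alpha\}\cup\{\theta\};\mathcal A_-\setminus\{\alpha'\}\cup\{\alpha'-\alpha+\theta\})$; if $\alpha'<\alpha$, first type $(\mathcal A_+\setminus\{\alpha\}\cup\{\alpha-\alpha'-\theta,\theta\};\mathcal A_-\setminus\{\alpha'\})$, second type $(\mathcal A_+\setminus\{\alpha\}\cup\{\alpha-\alpha'+\theta\};\mathcal A_-\setminus\{\alpha'\}\cup\{\theta\})$. For positive integers $f,g,h$ depending on $m$, $g\overset{h}{\approx}f$ means $|g-f|=O(h)$; arrays approximate each other with scale $h$ if they have the same type and their coefficients can be matched side by side with corresponding ones approximating with scale $h$. *)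

theory Defs
  imports Complex_Main "HOL-Library.Multiset" "HOL-Library.Landau_Symbols"
begin

text \<open>
  Everything lives in families indexed by \<open>m\<close>; pointwise requirements are imposed for all
  sufficiently large \<open>m\<close>, and \<open>O\<close>, \<open>\<Omega>\<close>, \<open>o\<close> refer to \<open>m \<longlongrightarrow> \<infinity>\<close>.
\<close>

definition plastic :: "real \<Rightarrow> real \<Rightarrow> nat \<Rightarrow> (nat \<Rightarrow> nat set) \<Rightarrow> bool" where
  "plastic a b t R \<longleftrightarrow>
     0 < t \<and>
     (\<forall>\<^sub>F m in at_top. R m \<subseteq> {1..m} \<and> card (R m) = t) \<and>
     (let el = (\<lambda>i m. real (sorted_list_of_set (R m) ! (i - 1))) in
        (\<lambda>m. log 2 (el 1 m)) \<in> \<Omega>(\<lambda>m. log 2 (real m) powr b) \<and>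
        (\<lambda>m. log 2 (el t m)) \<in> O(\<lambda>m. log 2 (real m) powr a) \<and>
        (\<forall>i\<in>{1..<t}. (\<lambda>m. log 2 (el i m)) \<in> O(\<lambda>m. log 2 (el (i + 1) m) powr a)))"


definition perm_seq :: "nat \<Rightarrow> nat set \<Rightarrow> nat list \<Rightarrow> bool" where
  "perm_seq k R U \<longleftrightarrow> length U = k \<and> distinct U \<and> set U \<subseteq> R"

definition monotonic :: "nat list \<Rightarrow> bool" where
  "monotonic U \<longleftrightarrow> (\<exists>n. sorted_wrt (<) (rotate n U) \<or> sorted_wrt (>) (rotate n U))"

definition del_max :: "nat list \<Rightarrow> nat list" where
  "del_max U = remove1 (Max (set U)) U"

definition tau :: "nat list \<Rightarrow> nat" where
  "tau U = (LEAST j. monotonic ((del_max ^^ j) U))"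


text \<open>
  An array is a pair of multisets of positive integers. Integers are used for the entries so
  that subtraction is not truncated; positivity is the predicate \<open>is_array\<close>.
\<close>

type_synonym arr = "int multiset \<times> int multiset"

definition entries :: "arr \<Rightarrow> int multiset" where
  "entries A = fst A + snd A"

definition is_array :: "arr \<Rightarrow> bool" where
  "is_array A \<longleftrightarrow> (\<forall>x\<in>#entries A. 0 < x)"

definition invariant_array :: "arr \<Rightarrow> bool" where
  "invariant_array A \<longleftrightarrow> sum_mset (fst A) = sum_mset (snd A)"

definition distinct_array :: "arr \<Rightarrow> bool" where
  "distinct_array A \<longleftrightarrow> (\<forall>x. count (entries A) x \<le> 1)"

text \<open>The coefficient of index \<open>i\<close> is \<open>u\<^sub>i - u\<^sub>i\<^sub>-\<^sub>1\<close>, indices being read cyclically.\<close>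

definition seq_coeffs :: "nat list \<Rightarrow> int multiset" where
  "seq_coeffs U = (let k = length U in
     mset (map (\<lambda>i. int (U ! i) - int (U ! ((i + k - 1) mod k))) [0..<k]))"

definition seq_array :: "nat list \<Rightarrow> arr" where
  "seq_array U =
     (filter_mset (\<lambda>c. 0 < c) (seq_coeffs U),
      image_mset abs (filter_mset (\<lambda>c. c < 0) (seq_coeffs U)))"


definition max_pos :: "arr \<Rightarrow> int" where
  "max_pos A = Max (set_mset (fst A))"

definition max_neg :: "arr \<Rightarrow> int" where
  "max_neg A = Max (set_mset (snd A))"

definition Zset :: "arr \<Rightarrow> int set" where
  "Zset A = (set_mset (fst A) \<union> set_mset (snd A) \<union> {\<bar>max_pos A - max_neg A\<bar>})
              - {max_pos A, max_neg A}"

definition feasible :: "real \<Rightarrow> real \<Rightarrow> (nat \<Rightarrow> arr) \<Rightarrow> bool" where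
  "feasible a b' A \<longleftrightarrow>
     0 < a \<and> a < 1 \<and> 0 < b' \<and> b' < 1 \<and>
     (\<forall>\<^sub>F m in at_top. fst (A m) \<noteq> {#} \<and> snd (A m) \<noteq> {#} \<and>
        is_array (A m) \<and> invariant_array (A m) \<and> distinct_array (A m)) \<and>
     (\<lambda>m. real_of_int \<bar>max_neg (A m) - max_pos (A m)\<bar>)
        \<in> o(\<lambda>m. real_of_int (max_pos (A m))) \<and>
     (\<lambda>m. log 2 (real_of_int (max_pos (A m)))) \<in> O(\<lambda>m. log 2 (real m) powr a) \<and>
     (\<exists>c>0. \<exists>C>0. \<forall>\<^sub>F m in at_top. \<forall>w\<in>Zset (A m).
        c * log 2 (real m) powr b' \<le> log 2 (real_of_int w) \<and>
        log 2 (real_of_int w) \<le> C * log 2 (real_of_int (max_pos (A m))) powr a)"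


definition delta :: "arr \<Rightarrow> int" where
  "delta A = Min (set_mset (entries A) \<union>
     {\<bar>v - w\<bar> | v w. v \<in># entries A \<and> w \<in># entries A \<and> v \<noteq> w})"

datatype anc_type = First | Second

text \<open>
  The last branch is meant for \<open>max_neg A < max_pos A\<close>: in a feasible family the two maxima
  are distinct for large \<open>m\<close>.
\<close>

definition anc_array :: "anc_type \<Rightarrow> int \<Rightarrow> arr \<Rightarrow> arr" where
  "anc_array ty \<theta> A =
     (let \<alpha> = max_pos A; \<alpha>' = max_neg A; P = fst A - {#\<alpha>#}; N = snd A - {#\<alpha>'#} in
      if \<alpha>' > \<alpha> then
        (case ty of
           First \<Rightarrow> (P, N + {#\<alpha>' - \<alpha> - \<theta>, \<theta>#})
         | Second \<Rightarrow> (P + {#\<theta>#}, N + {#\<alpha>' - \<alpha> + \<theta>#}))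
      else
        (case ty of
           First \<Rightarrow> (P + {#\<alpha> - \<alpha>' - \<theta>, \<theta>#}, N)
         | Second \<Rightarrow> (P + {#\<alpha> - \<alpha>' + \<theta>#}, N + {#\<theta>#})))"

text \<open>
  \<open>ancestor a ty \<theta> A B\<close>: the conditions under which ancestors of \<open>A\<close> by \<open>\<theta>\<close> are defined hold,
  and \<open>B\<close> is the ancestor of type \<open>ty\<close> (in particular, its entries are positive).
\<close>

definition ancestor ::
  "real \<Rightarrow> anc_type \<Rightarrow> (nat \<Rightarrow> int) \<Rightarrow> (nat \<Rightarrow> arr) \<Rightarrow> (nat \<Rightarrow> arr) \<Rightarrow> bool" where
  "ancestor a ty \<theta> A B \<longleftrightarrow>
     (\<exists>b'. feasible a b' A) \<and>
     (\<forall>\<^sub>F m in at_top. 2 \<le> size (fst (A m)) \<and> 2 \<le> size (snd (A m))) \<and>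
     filterlim \<theta> at_top at_top \<and>
     (\<lambda>m. real_of_int (\<theta> m)) \<in> O(\<lambda>m. 2 powr (log 2 (real_of_int (delta (A m))) powr a)) \<and>
     (\<forall>\<^sub>F m in at_top. B m = anc_array ty (\<theta> m) (A m) \<and> is_array (B m))"


text \<open>\<open>rel_mset\<close> provides the matching on each side, and forces equal types.\<close>

definition approx_arrays :: "(nat \<Rightarrow> int) \<Rightarrow> (nat \<Rightarrow> arr) \<Rightarrow> (nat \<Rightarrow> arr) \<Rightarrow> bool" where
  "approx_arrays h A B \<longleftrightarrow>
     (\<exists>C::real. \<forall>\<^sub>F m in at_top.
        rel_mset (\<lambda>x y. real_of_int \<bar>x - y\<bar> \<le> C * real_of_int (h m)) (fst (A m)) (fst (B m)) \<and>
        rel_mset (\<lambda>x y. real_of_int \<bar>x - y\<bar> \<le> C * real_of_int (h m)) (snd (A m)) (snd (B m)))"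

text \<open>
  In an array with mutually distinct entries, the side containing \<open>x\<close> is unique.
\<close>

definition remove_coeff :: "int \<Rightarrow> arr \<Rightarrow> arr" where
  "remove_coeff x A =
     (if x \<in># fst A then (fst A - {#x#}, snd A) else (fst A, snd A - {#x#}))"

text \<open>
  The numbers \<open>\<theta>\<^sub>j\<close> with \<open>j \<ge> 1\<close>; index \<open>0\<close>, with value \<open>min U\<close>, only serves to start the recursion.
\<close>

primrec theta :: "real \<Rightarrow> nat list \<Rightarrow> nat \<Rightarrow> int" where
  "theta a U 0 = int (Min (set U))"
| "theta a U (Suc j) = \<lfloor>2 powr (log 2 (real_of_int (theta a U j)) powr a)\<rfloor>"

end

theory Submission
  imports Defs
begin

text \<open>
  An array is recorded by the multiset of its signed coefficients, in which the opposite signs of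
  the two sides are kept. Taking an ancestor by \<open>\<theta>\<close> then replaces the extreme coefficients \<open>\<alpha>\<close> and
  \<open>-\<alpha>'\<close> by \<open>\<alpha> - \<alpha>' - s\<theta>\<close> and \<open>s\<theta>\<close>, where the sign \<open>s\<close> encodes the type, while deleting the maximum
  of a sequence replaces its two extreme coefficients by their sum. Hence the \<open>i\<close>-th array consists
  of the coefficients of \<open>U\<^sup>(\<^sup>i\<^sup>)\<close>, each perturbed by at most \<open>(2\<^sup>i - 1)\<theta>\<^sub>1\<close>, together with
  \<open>\<plusminus>\<theta>\<^sub>1, \<dots>, \<plusminus>\<theta>\<^sub>i\<close>. Plasticity makes the elements of \<open>U\<close> and the numbers \<open>\<theta>\<^sub>j\<close> so sparse that
  these perturbations affect neither signs nor distinctness nor the position of the maxima.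
\<close>

section \<open>Signed multisets\<close>

text \<open>The four ancestor formulas, for two types and two signs of
  \<open>\<alpha>' - \<alpha>\<close>, become a single operation on signed multisets. It preserves
  the total, so invariance just says that the total is zero. The bound \<open>2^i - 1\<close> solves
  \<open>E(i+1) = 2 * E(i) + 1\<close>: the merged coefficient inherits the errors of both extreme
  coefficients and gains one more \<open>\<theta>\<close>. The construction sustains itself because
  all entries of the \<open>i\<close>-th array and all differences of two entries are at least
  \<open>\<theta>\<^sub>i\<close>. Hence \<open>\<delta>\<close> is at least
  \<open>\<theta>\<^sub>i\<close>, and rounding down \<open>2^(log^a \<theta>\<^sub>i)\<close> meets
  the size condition for the next ancestor. All of this is arithmetic at a single \<open>m\<close>,
  resting on finitely many inequalities because the number of steps is fixed; limits enter only to
  show that these inequalities hold eventually.\<close>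

definition signed_array :: "int multiset \<Rightarrow> arr" where
  "signed_array X = (filter_mset (\<lambda>c. 0 < c) X, image_mset abs (filter_mset (\<lambda>c. c < 0) X))"

lemma seq_array_signed: "seq_array U = signed_array (seq_coeffs U)"
  by (simp add: seq_array_def signed_array_def)

lemma entries_signed_array: "0 \<notin># X \<Longrightarrow> entries (signed_array X) = image_mset abs X"
  by (induction X) (auto simp: entries_def signed_array_def)

lemma sum_signed_array:
  "sum_mset (fst (signed_array X)) - sum_mset (snd (signed_array X)) = sum_mset X"
  by (induction X) (auto simp: signed_array_def)

text \<open>Absolute values are compared because distinctness and \<open>delta\<close> concern both
  sides of an array together. Letting \<open>y\<close> range over the multiset with one copy of
  \<open>x\<close> removed makes a repeated coefficient violate the condition when
  \<open>0 < g\<close>.\<close>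

definition spread :: "int \<Rightarrow> int multiset \<Rightarrow> bool" where
  "spread g X \<longleftrightarrow> (\<forall>x\<in>#X. g \<le> \<bar>x\<bar> \<and> (\<forall>y\<in>#X - {#x#}. g \<le> \<bar>\<bar>x\<bar> - \<bar>y\<bar>\<bar>))"

lemma spread_image:
  assumes "\<And>c. c \<in># C \<Longrightarrow> g \<le> \<bar>f c\<bar>"
    and "\<And>c d. c \<in># C \<Longrightarrow> d \<in># C - {#c#} \<Longrightarrow> g \<le> \<bar>\<bar>f c\<bar> - \<bar>f d\<bar>\<bar>"
  shows "spread g (image_mset f C)"
proof -
  have "image_mset f C - {#f c#} = image_mset f (C - {#c#})" if "c \<in># C" for c
    using that by (simp add: image_mset_Diff)
  then show ?thesis using assms by (auto simp: spread_def)
qed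

lemma spread_union:
  assumes "spread g A" and "spread g B"
    and "\<And>x y. x \<in># A \<Longrightarrow> y \<in># B \<Longrightarrow> g \<le> \<bar>\<bar>x\<bar> - \<bar>y\<bar>\<bar>"
  shows "spread g (A + B)"
proof -
  have 1: "A + B - {#x#} = (A - {#x#}) + B" if "x \<in># A" for x
    using multi_member_split[OF that] by auto
  have 2: "A + B - {#x#} = A + (B - {#x#})" if "x \<in># B" for x
    using that by simp
  show ?thesis unfolding spread_def
  proof (intro ballI conjI)
    fix x assume x: "x \<in># A + B"
    then show "g \<le> \<bar>x\<bar>" using assms by (auto simp: spread_def)
    fix y assume y: "y \<in># A + B - {#x#}"
    have s: "g \<le> \<bar>\<bar>y\<bar> - \<bar>x\<bar>\<bar>" if "x \<in># B" "y \<in># A" using assms(3)[of y x] that by simp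
    show "g \<le> \<bar>\<bar>x\<bar> - \<bar>y\<bar>\<bar>"
    proof (cases "x \<in># A")
      case True
      then show ?thesis using y assms unfolding spread_def 1[OF True] by (metis union_iff)
    next
      case False
      then have "x \<in># B" using x by simp
      then show ?thesis using y assms(2) s unfolding spread_def 2[OF \<open>x \<in># B\<close>]
        by (metis union_iff abs_minus_commute)
    qed
  qed
qed

lemma spread_subset:
  assumes "spread g X" and "Y \<subseteq># X"
  shows "spread g Y"
proof -
  obtain Z where "X = Y + Z" using assms(2) by (metis subset_mset.le_iff_add)
  moreover have "Y + Z - {#x#} = (Y - {#x#}) + Z" if "x \<in># Y" for x
    using multi_member_split[OF that] by auto
  ultimately show ?thesis using assms(1) unfolding spread_def by (metis union_iff)
qed

lemma spread_nonzero: "spread g X \<Longrightarrow> 0 < g \<Longrightarrow> 0 \<notin># X"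
  by (auto simp: spread_def)

text \<open>The entries are the absolute values of the signed coefficients, so one bound on these
  and on their differences yields positivity, distinctness and the estimate of \<open>delta\<close>.
  The last one later certifies that the next \<theta> is small enough.\<close>

lemma spread_array:
  assumes "spread g X" and "0 < g"
  shows "is_array (signed_array X)" "distinct_array (signed_array X)"
    "X \<noteq> {#} \<Longrightarrow> g \<le> delta (signed_array X)"
proof -
  note e = entries_signed_array[OF spread_nonzero[OF assms]]
  show "is_array (signed_array X)"
    using assms by (auto simp: is_array_def e spread_def dest!: spread_nonzero)
  show "distinct_array (signed_array X)" unfolding distinct_array_def
  proof
    fix v
    show "count (entries (signed_array X)) v \<le> 1"
    proof (cases "\<exists>x\<in>#X. v = \<bar>x\<bar>")
      case True
      then obtain x where x: "x \<in># X" "v = \<bar>x\<bar>" by blast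
      then obtain Y where Y: "X = add_mset x Y" by (metis insert_DiffM)
      then have "v \<notin># image_mset abs Y" using assms x by (force simp: spread_def)
      then have "count (image_mset abs Y) v = 0" by (simp only: not_in_iff)
      then have "count (image_mset abs X) v = 1" using x Y by simp
      then show ?thesis by (simp only: e)
    next
      case False
      then have "v \<notin># image_mset abs X" by auto
      then show ?thesis by (simp only: e not_in_iff)
    qed
  qed
  assume X: "X \<noteq> {#}"
  let ?D = "{\<bar>v - w\<bar> | v w. v \<in># entries (signed_array X) \<and> w \<in># entries (signed_array X) \<and> v \<noteq> w}"
  have "?D \<subseteq> (\<lambda>(v, w). \<bar>v - w\<bar>) ` (set_mset (entries (signed_array X)) \<times> set_mset (entries (signed_array X)))"
    by auto
  then have "finite ?D" by (rule finite_subset) simp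
  moreover have "g \<le> d" if d: "d \<in> ?D" for d
  proof -
    from d obtain x y where xy: "x \<in># X" "y \<in># X" "\<bar>x\<bar> \<noteq> \<bar>y\<bar>" "d = \<bar>\<bar>x\<bar> - \<bar>y\<bar>\<bar>" by (auto simp: e)
    then have "y \<in># X - {#x#}" by (metis insert_DiffM insert_noteq_member)
    then show ?thesis using xy assms by (auto simp: spread_def)
  qed
  ultimately show "g \<le> delta (signed_array X)" unfolding delta_def
    using X assms by (subst Min_ge_iff) (auto simp: e spread_def)
qed

lemma max_signed_array:
  assumes "0 < p" "0 < q" and "\<And>y. y \<in># Y \<Longrightarrow> -q < y \<and> y < p"
  shows "max_pos (signed_array (add_mset p (add_mset (-q) Y))) = p"
    and "max_neg (signed_array (add_mset p (add_mset (-q) Y))) = q"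
proof -
  show "max_pos (signed_array (add_mset p (add_mset (-q) Y))) = p"
    unfolding max_pos_def using assms by (intro Max_eqI) (auto simp: signed_array_def less_imp_le)
  have "\<bar>y\<bar> \<le> q" if "y \<in># Y" "y < 0" for y using assms(3)[OF that(1)] that(2) by linarith
  then show "max_neg (signed_array (add_mset p (add_mset (-q) Y))) = q"
    unfolding max_neg_def using assms(1,2) by (intro Max_eqI) (auto simp: signed_array_def)
qed

text \<open>The two new signed coefficients sum to \<open>p - q\<close>. The first type puts both on
  the side of the larger maximum, the second type separates them, which determines the sign
  \<open>s\<close> of \<theta>. The bound on \<theta> ensures that
  \<open>p - q - s * \<theta>\<close> keeps the sign of \<open>p - q\<close>.\<close>

lemma anc_signed_array:
  assumes "0 < p" "0 < q" and "\<And>y. y \<in># Y \<Longrightarrow> -q < y \<and> y < p"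
    and "0 < \<theta>" "\<theta> < \<bar>p - q\<bar>"
  shows "\<exists>s\<in>{1, -1}. anc_array ty \<theta> (signed_array (add_mset p (add_mset (-q) Y))) =
    signed_array (add_mset (p - q - s * \<theta>) (add_mset (s * \<theta>) Y))"
proof -
  have max: "max_pos (signed_array (add_mset p (add_mset (-q) Y))) = p"
    "max_neg (signed_array (add_mset p (add_mset (-q) Y))) = q"
    using max_signed_array[OF assms(1,2)] assms(3) by blast+
  have "anc_array ty \<theta> (signed_array (add_mset p (add_mset (-q) Y))) =
    signed_array (add_mset (p - q - s * \<theta>) (add_mset (s * \<theta>) Y))"
    if "s = (if (p < q) = (ty = First) then -1 else 1)" for s
    unfolding anc_array_def Let_def max
    using assms(1,2,4,5) that
    by (cases ty) (auto simp: signed_array_def)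
  then show ?thesis by (auto split: if_splits)
qed

text \<open>\<open>remove_coeff\<close> tests the positive side first, so for \<open>s = -1\<close>
  the value \<open>x\<close> must be known to be absent there.\<close>

lemma remove_coeff_signed_array:
  assumes "s \<in> {1, -1}" "0 < x" and "\<And>y. y \<in># Y \<Longrightarrow> \<bar>y\<bar> \<noteq> x"
  shows "remove_coeff x (signed_array (add_mset (s * x) Y)) = signed_array Y"
proof -
  have "x \<notin># Y" using assms(2) assms(3)[of x] by auto
  then show ?thesis using assms(1,2) by (auto simp: remove_coeff_def signed_array_def)
qed

text \<open>\<open>spread\<close> identifies \<open>th j\<close> by its absolute value alone, and it
  passes to sub-multisets, so it is still available after each removal.\<close>

lemma fold_remove_coeff_signed_array:
  assumes "\<And>j. s j \<in> {1, -1}" "0 < g" "\<And>j. j \<in> set js \<Longrightarrow> 0 < (th j :: int)"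
    and "spread g (P + image_mset (\<lambda>j. s j * th j) (mset js))"
  shows "fold remove_coeff (map th js)
    (signed_array (P + image_mset (\<lambda>j. s j * th j) (mset js))) = signed_array P"
  using assms(3,4)
proof (induction js)
  case (Cons j js)
  let ?Y = "P + image_mset (\<lambda>j. s j * th j) (mset js)"
  have sp: "spread g (add_mset (s j * th j) ?Y)" using Cons.prems by simp
  have j: "\<bar>s j * th j\<bar> = th j" using assms(1)[of j] Cons.prems(1)[of j] by auto
  have "\<bar>y\<bar> \<noteq> th j" if "y \<in># ?Y" for y
  proof -
    have "g \<le> \<bar>\<bar>s j * th j\<bar> - \<bar>y\<bar>\<bar>" using sp that unfolding spread_def by simp
    then show ?thesis using j assms(2) by auto
  qed
  then have "remove_coeff (th j) (signed_array (add_mset (s j * th j) ?Y)) = signed_array ?Y"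
    using assms(1)[of j] Cons.prems(1)[of j] by (intro remove_coeff_signed_array) auto
  moreover have "spread g ?Y"
    using sp by (rule spread_subset) simp
  ultimately show ?case using Cons by simp
qed simp


section \<open>Coefficients of cyclic sequences\<close>

text \<open>These are the differences of the cycle cut open between its last and first element.
  Recursion on lists replaces the indices modulo the length; the missing closing difference is
  restored in \<open>seq_coeffs_path_diffs\<close>.\<close>

fun path_diffs :: "nat list \<Rightarrow> int list" where
  "path_diffs (x # y # zs) = (int y - int x) # path_diffs (y # zs)"
| "path_diffs _ = []"

lemma path_diffs_nth: "path_diffs xs = map (\<lambda>i. int (xs ! Suc i) - int (xs ! i)) [0..<length xs - 1]"
proof (induction xs rule: path_diffs.induct)
  case (1 x y zs)
  have "[0..<length (x # y # zs) - 1] = 0 # map Suc [0..<length (y # zs) - 1]"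
    by (simp only: map_Suc_upt) (simp add: upt_rec)
  then show ?case using 1 by simp
qed auto

lemma path_diffs_append:
  "xs \<noteq> [] \<Longrightarrow> ys \<noteq> [] \<Longrightarrow> path_diffs (xs @ ys) = path_diffs xs @ (int (hd ys) - int (last xs)) # path_diffs ys"
proof (induction xs rule: path_diffs.induct)
  case ("2_2" v)
  then show ?case by (cases ys) auto
qed auto

lemma path_diffs_Cons: "W \<noteq> [] \<Longrightarrow> path_diffs (x # W) = (int (hd W) - int x) # path_diffs W"
  by (cases W) auto

lemma seq_coeffs_path_diffs:
  assumes "V \<noteq> []"
  shows "seq_coeffs V = add_mset (int (hd V) - int (last V)) (mset (path_diffs V))"
proof -
  obtain k where k: "length V = Suc k" using assms by (cases V) auto
  have "[0..<Suc k] = 0 # map Suc [0..<k]" by (simp only: map_Suc_upt) (simp add: upt_rec)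
  moreover have "Suc (i + k) mod Suc k = i" if "i < k" for i
    using that mod_add_self2[of i "Suc k"] by simp
  moreover have "hd V = V ! 0" "last V = V ! k" using assms k by (auto simp: hd_conv_nth last_conv_nth)
  ultimately show ?thesis unfolding seq_coeffs_def path_diffs_nth Let_def k
    by (auto simp: comp_def simp del: upt_Suc mset_map intro!: arg_cong[where f = mset])
qed

lemma seq_coeffs_rotate: "seq_coeffs (xs @ ys) = seq_coeffs (ys @ xs)"
  by (cases "xs = [] \<or> ys = []") (auto simp: seq_coeffs_path_diffs path_diffs_append)

lemma size_seq_coeffs: "size (seq_coeffs V) = length V"
  by (simp add: seq_coeffs_def Let_def)

lemma sum_path_diffs: "V \<noteq> [] \<Longrightarrow> sum_list (path_diffs V) = int (last V) - int (hd V)"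
  by (induction V rule: path_diffs.induct) auto

lemma sum_seq_coeffs: "V \<noteq> [] \<Longrightarrow> sum_mset (seq_coeffs V) = 0"
  by (simp add: seq_coeffs_path_diffs sum_mset_sum_list sum_path_diffs)

lemma in_path_diffs:
  "d \<in> set (path_diffs W) \<Longrightarrow> distinct W \<Longrightarrow> \<exists>x\<in>set W. \<exists>y\<in>set W. x \<noteq> y \<and> d = int y - int x"
proof (induction W rule: path_diffs.induct)
  case (1 x y zs)
  from 1(2) consider "d = int y - int x" | "d \<in> set (path_diffs (y # zs))" by auto
  then show ?case
  proof cases
    case 1
    then show ?thesis using "1.prems" by (auto intro: bexI[of _ x] bexI[of _ y])
  next
    case 2
    then show ?thesis using "1.IH" "1.prems" by (auto; blast)
  qed
qed auto

lemma path_diffs_pos_sorted: "\<forall>d\<in>set (path_diffs W). 0 < d \<Longrightarrow> sorted_wrt (<) W"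
  by (induction W rule: path_diffs.induct) (auto simp: sorted_wrt2 sorted_wrt1 simp del: sorted_wrt.simps(2))

lemma path_diffs_neg_sorted: "\<forall>d\<in>set (path_diffs W). d < 0 \<Longrightarrow> sorted_wrt (>) W"
  by (induction W rule: path_diffs.induct) (auto simp: sorted_wrt2 sorted_wrt1 simp del: sorted_wrt.simps(2))

text \<open>\<open>W\<close> is the cycle cut at its maximum. Both rotations are provided since the
  maximum opens a decreasing list but closes an increasing one. If \<open>V = xs @ M # ys\<close>,
  then \<open>W = ys @ xs\<close>, which is a rotation of \<open>del_max V\<close>.\<close>

lemma rotate_to_max:
  assumes "distinct V" "V \<noteq> []"
  obtains W n n' where "rotate n V = Max (set V) # W" "rotate n' V = W @ [Max (set V)]"
    "seq_coeffs V = seq_coeffs (Max (set V) # W)" "seq_coeffs (del_max V) = seq_coeffs W"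
    "distinct W" "set W = set V - {Max (set V)}" "length V = Suc (length W)"
proof -
  let ?M = "Max (set V)"
  have "?M \<in> set V" using assms by simp
  then obtain xs ys where V: "V = xs @ ?M # ys" using split_list by metis
  define M where "M = ?M"
  have V: "V = xs @ M # ys" using V by (simp add: M_def)
  have d: "del_max V = xs @ ys" using assms V unfolding del_max_def M_def[symmetric]
    by (simp add: remove1_append)
  show thesis
    by (rule that[of "length xs" "ys @ xs" "Suc (length xs)", folded M_def])
      (use assms V d rotate_append[of "xs @ [M]" ys] in
        \<open>auto simp: rotate_append seq_coeffs_rotate[of xs "M # ys"] seq_coeffs_rotate[of xs ys]\<close>)
qed

lemma del_max_facts:
  assumes "distinct V" "V \<noteq> []"
  shows "set (del_max V) \<subseteq> set V" "distinct (del_max V)" "length (del_max V) = length V - 1"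
  using assms by (auto simp: del_max_def length_remove1 dest: notin_set_remove1)

text \<open>
  Next to its maximum, a sequence has one positive and one negative coefficient; if all the others
  had the same sign, cutting the cycle at the maximum would leave a monotonic list.
\<close>

lemma non_monotonic_sizes:
  assumes "distinct V" "\<not> monotonic V"
  shows "2 \<le> size (filter_mset (\<lambda>c. 0 < c) (seq_coeffs V))"
    "2 \<le> size (filter_mset (\<lambda>c. c < 0) (seq_coeffs V))"
    "4 \<le> length V"
proof -
  have V: "V \<noteq> []" using assms by (auto simp: monotonic_def)
  obtain W n n' where W: "rotate n V = Max (set V) # W" "rotate n' V = W @ [Max (set V)]"
    "seq_coeffs V = seq_coeffs (Max (set V) # W)" "distinct W" "set W = set V - {Max (set V)}"
    using rotate_to_max[OF assms(1) V] by metis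
  define M where "M = Max (set V)"
  have Wne: "W \<noteq> []" using assms(2) W(1) unfolding monotonic_def
    by (metis sorted_wrt1)
  have lt: "x < M" if "x \<in> set W" for x
  proof -
    have "x \<le> M" using that W(5) by (simp add: M_def)
    moreover have "x \<noteq> M" using that W(5) by (simp add: M_def)
    ultimately show ?thesis by simp
  qed
  have hl: "hd W < M" "last W < M" using Wne lt by auto
  have sc: "seq_coeffs V = add_mset (int M - int (last W)) (add_mset (int (hd W) - int M) (mset (path_diffs W)))"
    using W(3) Wne by (simp add: M_def seq_coeffs_path_diffs path_diffs_Cons)
  have nz: "d \<noteq> 0" if "d \<in> set (path_diffs W)" for d using in_path_diffs[OF that W(4)] by auto
  have "\<not> sorted_wrt (>) (M # W)" "\<not> sorted_wrt (<) (W @ [M])"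
    using assms(2) W(1,2) unfolding monotonic_def M_def by metis+
  then have "\<not> sorted_wrt (>) W" "\<not> sorted_wrt (<) W"
    using lt by (auto simp: sorted_wrt_append)
  then obtain d d' where d: "d \<in> set (path_diffs W)" "d > 0" and d': "d' \<in> set (path_diffs W)" "d' < 0"
    using path_diffs_pos_sorted path_diffs_neg_sorted nz by (metis linorder_neqE_linordered_idom)
  have "filter_mset (\<lambda>c. 0 < c) (mset (path_diffs W)) \<noteq> {#}"
    using d by (auto simp: filter_mset_eq_conv)
  moreover have "filter_mset (\<lambda>c. c < 0) (mset (path_diffs W)) \<noteq> {#}"
    using d' by (auto simp: filter_mset_eq_conv)
  ultimately have 1: "0 < size (filter_mset (\<lambda>c. 0 < c) (mset (path_diffs W)))"
     "0 < size (filter_mset (\<lambda>c. c < 0) (mset (path_diffs W)))"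
    by (metis nonempty_has_size)+
  then show 2: "2 \<le> size (filter_mset (\<lambda>c. 0 < c) (seq_coeffs V))"
    "2 \<le> size (filter_mset (\<lambda>c. c < 0) (seq_coeffs V))"
    using hl unfolding sc by auto
  have "size (filter_mset (\<lambda>c. 0 < c) X) + size (filter_mset (\<lambda>c. c < 0) X) \<le> size X" for X :: "int multiset"
    by (induction X) auto
  from this[of "seq_coeffs V"] show "4 \<le> length V" using 2 by (simp add: size_seq_coeffs)
qed


section \<open>Perturbed coefficients\<close>

text \<open>The error \<open>e\<close> depends on the value of a coefficient, not on its position;
  this loses nothing where the coefficients are pairwise distinct. The total is recorded separately
  because size bounds on \<open>e\<close> do not determine it.\<close>

definition tracked :: "(nat \<Rightarrow> int) \<Rightarrow> nat list \<Rightarrow> nat \<Rightarrow> int multiset \<Rightarrow> bool" where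
  "tracked th V i X \<longleftrightarrow> sum_mset X = 0 \<and>
     (\<exists>e s. (\<forall>c. \<bar>e c\<bar> \<le> (2 ^ i - 1) * th 1) \<and> (\<forall>j. s j \<in> {1, -1}) \<and>
        X = image_mset (\<lambda>c. c + e c) (seq_coeffs V) + image_mset (\<lambda>j. s j * th j) (mset [1..<Suc i]))"

lemma tracked_0: "V \<noteq> [] \<Longrightarrow> tracked th V 0 (seq_coeffs V)"
  unfolding tracked_def
  by (intro conjI exI[of _ "\<lambda>_. 0"] exI[of _ "\<lambda>_. 1"]) (auto simp: sum_seq_coeffs)

lemma rel_mset_image:
  "(\<And>c. c \<in># C \<Longrightarrow> R (f c) (g c)) \<Longrightarrow> rel_mset R (image_mset f C) (image_mset g C)"
  by (induction C) (auto intro: rel_mset_Zero rel_mset_Plus)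

text \<open>\<open>n\<close> is the number of steps. The factor between \<open>th 0\<close> and
  \<open>th 1\<close> is large because the errors, up to \<open>2^n * th 1\<close>, must stay well
  below the gaps between coefficients, for which \<open>th 0\<close> is the lower bound. The later
  values enter the arrays unperturbed, so a factor 2 suffices to keep them apart.\<close>

locale separated =
  fixes S :: "nat set" and th :: "nat \<Rightarrow> int" and n :: nat
  assumes th_0_le: "x \<in> S \<Longrightarrow> th 0 \<le> int x"
    and gap: "x \<in> S \<Longrightarrow> y \<in> S \<Longrightarrow> x < y \<Longrightarrow> 4 * x \<le> y"
    and th_1_le: "2 ^ (n + 4) * th 1 \<le> th 0"
    and th_Suc_le: "1 \<le> j \<Longrightarrow> j < n \<Longrightarrow> 2 * th (Suc j) \<le> th j"
    and th_pos: "j \<le> Suc n \<Longrightarrow> 0 < th j"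
begin

lemma th_1_pos: "0 < th 1"
  using th_pos[of 1] by simp

lemma th_antimono:
  assumes "1 \<le> j" "j \<le> l" "l \<le> n"
  shows "th l \<le> th j"
  using assms(2,3)
proof (induction l rule: dec_induct)
  case (step l)
  then show ?case using th_Suc_le[of l] th_pos[of "Suc l"] assms(1) by simp
qed simp

lemma th_halved:
  assumes "1 \<le> j" "j < l" "l \<le> n"
  shows "2 * th l \<le> th j"
  using th_Suc_le[of j] th_antimono[of "Suc j" l] assms by simp

lemma error_le: "i \<le> n \<Longrightarrow> 16 * (2 ^ i * th 1) \<le> th 0"
proof -
  assume "i \<le> n"
  then have "(2::int) ^ i \<le> 2 ^ n" by (simp add: power_increasing)
  then have "2 ^ i * th 1 \<le> 2 ^ n * th 1" using th_1_pos by (intro mult_right_mono) auto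
  moreover have "2 ^ (n + 4) * th 1 = 16 * (2 ^ n * th 1)" by (simp add: power_add)
  ultimately show ?thesis using th_1_le by linarith
qed

lemma error_nonneg: "0 \<le> (2 ^ i - 1) * th 1"
  using th_1_pos by simp

text \<open>By the first bound, coefficients at distance \<open>th 0\<close> keep distance
  \<open>th i\<close> after both have moved. By the second, they stay far above the inserted values,
  which are at most \<open>th 1\<close>.\<close>

lemma error_bounds:
  assumes "i \<le> n"
  shows "th i + 2 * ((2 ^ i - 1) * th 1) \<le> th 0"
    and "16 * ((2 ^ i - 1) * th 1) + 16 * th 1 \<le> th 0"
    and "1 \<le> i \<Longrightarrow> th i \<le> th 1"
proof -
  have *: "(2 ^ i - 1) * th 1 + th 1 = 2 ^ i * th 1" by (simp add: algebra_simps)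
  show 1: "16 * ((2 ^ i - 1) * th 1) + 16 * th 1 \<le> th 0" using error_le[OF assms] * by linarith
  show 2: "th i \<le> th 1" if "1 \<le> i" using that th_antimono[of 1 i] assms by simp
  show "th i + 2 * ((2 ^ i - 1) * th 1) \<le> th 0"
  \<comment> \<open>For \<open>i = 0\<close> there is no error and the claim is an equality; the
    comparison with \<open>th 1\<close> is available from \<open>i = 1\<close> on.\<close>
  proof (cases "i = 0")
    case False
    then have "th i \<le> th 1" using 2 by simp
    then show ?thesis using 1 error_nonneg[of i] th_1_pos by linarith
  qed simp
qed

lemma difference_ge:
  assumes "x \<in> S" "y \<in> S" "x \<noteq> y"
  shows "th 0 \<le> \<bar>int x - int y\<bar>"
  using gap[of x y] gap[of y x] th_0_le[of x] th_0_le[of y] assms by (cases "x < y") auto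

text \<open>The larger element dominates a difference: if \<open>x < z\<close>, then
  \<open>z - w\<close> is at least \<open>3z/4\<close>, hence at least \<open>3x\<close>, while
  \<open>x - y\<close> is at most \<open>x\<close>. If \<open>x = z\<close>, the gap is
  \<open>w - y\<close>, at least \<open>3y\<close>.\<close>

lemma ordered_difference_gap:
  assumes "x \<in> S" "y \<in> S" "z \<in> S" "w \<in> S" "y < x" "w < z" "x < z \<or> x = z \<and> y < w"
  shows "th 0 \<le> \<bar>(int x - int y) - (int z - int w)\<bar>"
proof -
  have le: "th 0 \<le> int x" "th 0 \<le> int y" "th 0 \<le> int z" "th 0 \<le> int w"
    using assms th_0_le by blast+
  have g: "4 * y \<le> x" "4 * w \<le> z" using assms gap by blast+
  from assms(7) show ?thesis
  proof
    assume "x < z"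
    then have "4 * x \<le> z" using assms gap by blast
    then show ?thesis using le g by linarith
  next
    assume "x = z \<and> y < w"
    then have "4 * y \<le> w" "x = z" using assms gap by blast+
    then show ?thesis using le g by linarith
  qed
qed

text \<open>Up to symmetry each pair is written with its larger element first; the pairs being
  different, their lexicographic order is strict.\<close>

lemma difference_gap:
  assumes S: "x \<in> S" "y \<in> S" "z \<in> S" "w \<in> S" and ne: "x \<noteq> y" "z \<noteq> w" "{x, y} \<noteq> {z, w}"
  shows "th 0 \<le> \<bar>\<bar>int x - int y\<bar> - \<bar>int z - int w\<bar>\<bar>"
proof -
  have ordered: "th 0 \<le> \<bar>\<bar>int x - int y\<bar> - \<bar>int z - int w\<bar>\<bar>"
    if "x \<in> S" "y \<in> S" "z \<in> S" "w \<in> S" "y < x" "w < z" "{x, y} \<noteq> {z, w}" for x y z w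
  proof -
    from that(7) consider "x < z \<or> x = z \<and> y < w" | "z < x \<or> z = x \<and> w < y" by force
    then show ?thesis
    proof cases
      case 1
      then show ?thesis using ordered_difference_gap[of x y z w] that by simp
    next
      case 2
      then show ?thesis using ordered_difference_gap[of z w x y] that by simp
    qed
  qed
  have sym: "\<bar>int u - int v\<bar> = \<bar>int v - int u\<bar>" for u v by simp
  show ?thesis
    using ordered[of x y z w] ordered[of y x z w] ordered[of x y w z] ordered[of y x w z] S ne
    unfolding sym[of y x] sym[of w z]
    by (metis insert_commute linorder_neqE_nat)
qed

text \<open>Coefficients correspond to the edges of a cycle. On at least three vertices, different
  edges have different vertex sets, so \<open>difference_gap\<close> applies; on two vertices both
  edges would coincide.\<close>

lemma spread_seq_coeffs:
  assumes "distinct V" "set V \<subseteq> S" "3 \<le> length V"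
  shows "spread (th 0) (seq_coeffs V)"
proof -
  define k where "k = length V"
  define p where "p i = (i + k - 1) mod k" for i
  have k: "3 \<le> k" using assms(3) by (simp add: k_def)
  have p: "p i = (if i = 0 then k - 1 else i - 1)" if "i < k" for i
  proof (cases i)
    case (Suc j)
    then have "i + k - 1 = j + k" by simp
    then show ?thesis using that Suc unfolding p_def by simp
  qed (use k in \<open>simp add: p_def\<close>)
  have pk: "p i < k" if "i < k" for i using k by (simp add: p_def)
  have inS: "V ! i \<in> S" if "i < k" for i using that assms(2) nth_mem[of i V] unfolding k_def by blast
  have eq: "V ! i = V ! j \<longleftrightarrow> i = j" if "i < k" "j < k" for i j
    using that assms(1) by (simp add: k_def nth_eq_iff_index_eq)
  have pi: "p i \<noteq> i" if "i < k" for i using p[OF that] k that by auto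
  have "spread (th 0) (image_mset (\<lambda>i. int (V ! i) - int (V ! p i)) (mset [0..<k]))"
  proof (rule spread_image)
    fix c assume "c \<in># mset [0..<k]"
    then have "c < k" by simp
    then show "th 0 \<le> \<bar>int (V ! c) - int (V ! p c)\<bar>"
      using inS pk eq pi[of c] by (intro difference_ge) auto
  next
    fix c d assume c: "c \<in># mset [0..<k]" and d: "d \<in># mset [0..<k] - {#c#}"
    have c: "c < k" using c by simp
    have "d \<in> set (remove1 c [0..<k])" using d by (metis mset_remove1 set_mset_mset)
    then have d: "d < k" "d \<noteq> c" by (simp_all add: set_remove1_eq)
    have "\<not> (c = p d \<and> d = p c)" using p[OF c] p[OF d(1)] c d k by (auto split: if_splits)
    then have "{V ! c, V ! p c} \<noteq> {V ! d, V ! p d}"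
      using c d pk eq by (auto simp: doubleton_eq_iff)
    then show "th 0 \<le> \<bar>\<bar>int (V ! c) - int (V ! p c)\<bar> - \<bar>int (V ! d) - int (V ! p d)\<bar>\<bar>"
      using c d inS pk eq pi[of c] pi[of d] by (intro difference_gap) auto
  qed
  moreover have "seq_coeffs V = image_mset (\<lambda>i. int (V ! i) - int (V ! p i)) (mset [0..<k])"
    by (simp only: seq_coeffs_def Let_def k_def p_def mset_map)
  ultimately show ?thesis by simp
qed

text \<open>The values at least halve from index to index, so two of them differ by at least the
  smaller one.\<close>

lemma spread_thetas:
  assumes "i \<le> n" "\<And>j. s j \<in> {1, -1}"
  shows "spread (th i) (image_mset (\<lambda>j. s j * th j) (mset [1..<Suc i]))"
proof (rule spread_image)
  have a: "\<bar>s j * th j\<bar> = th j" if "j \<in> {1..i}" for j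
    using assms(2)[of j] th_pos[of j] that assms(1) by auto
  fix c assume "c \<in># mset [1..<Suc i]"
  then have c: "c \<in> {1..i}" by auto
  show "th i \<le> \<bar>s c * th c\<bar>" using th_antimono[of c i] c assms(1) by (simp add: a)
  fix d assume d: "d \<in># mset [1..<Suc i] - {#c#}"
  have "d \<in> set (remove1 c [1..<Suc i])" using d by (metis mset_remove1 set_mset_mset)
  then have d: "d \<in> {1..i}" "d \<noteq> c" by (auto simp: set_remove1_eq simp del: upt_Suc)
  have "th i \<le> th d" "th i \<le> th c" using th_antimono c d assms(1) by simp_all
  moreover have "2 * th c \<le> th d \<or> 2 * th d \<le> th c"
    using th_halved[of c d] th_halved[of d c] c d assms(1) by (cases "c < d") auto
  moreover have "0 < th c" "0 < th d" using th_pos c d assms(1) by auto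
  ultimately show "th i \<le> \<bar>\<bar>s c * th c\<bar> - \<bar>s d * th d\<bar>\<bar>" unfolding a[OF c] a[OF d(1)] by linarith
qed

context
  fixes V :: "nat list" and i :: nat
  assumes V: "distinct V" "set V \<subseteq> S" "3 \<le> length V" and i: "i \<le> n"
begin

text \<open>Perturbed coefficients and inserted values are each spread by themselves. Across the two
  groups, a perturbed coefficient has size at least \<open>th 0\<close> minus one error, far above
  \<open>th 1\<close>.\<close>

lemma spread_perturbed:
  assumes e: "\<And>c. \<bar>e c\<bar> \<le> (2 ^ i - 1) * th 1" and s: "\<And>j. s j \<in> {1, -1}"
  shows "spread (th i) (image_mset (\<lambda>c. c + e c) (seq_coeffs V) + image_mset (\<lambda>j. s j * th j) (mset [1..<Suc i]))"
proof (rule spread_union)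
  have sp: "spread (th 0) (seq_coeffs V)" using spread_seq_coeffs V .
  show "spread (th i) (image_mset (\<lambda>c. c + e c) (seq_coeffs V))"
  proof (rule spread_image)
    fix c assume c: "c \<in># seq_coeffs V"
    then have "th 0 \<le> \<bar>c\<bar>" using sp by (simp add: spread_def)
    then show "th i \<le> \<bar>c + e c\<bar>" using e[of c] error_bounds(1)[OF i] by linarith
    fix d assume "d \<in># seq_coeffs V - {#c#}"
    then have "th 0 \<le> \<bar>\<bar>c\<bar> - \<bar>d\<bar>\<bar>" using sp c unfolding spread_def by blast
    then show "th i \<le> \<bar>\<bar>c + e c\<bar> - \<bar>d + e d\<bar>\<bar>" using e[of c] e[of d] error_bounds(1)[OF i]
      by linarith
  qed
  show "spread (th i) (image_mset (\<lambda>j. s j * th j) (mset [1..<Suc i]))"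
    using spread_thetas i s .
  fix x y assume "x \<in># image_mset (\<lambda>c. c + e c) (seq_coeffs V)"
    and "y \<in># image_mset (\<lambda>j. s j * th j) (mset [1..<Suc i])"
  then obtain c j where c: "c \<in># seq_coeffs V" "x = c + e c" and j: "1 \<le> j" "j \<le> i" "y = s j * th j"
    by (auto simp: less_Suc_eq_le simp del: upt_Suc)
  have "th 0 \<le> \<bar>c\<bar>" using sp c by (simp add: spread_def)
  moreover have "\<bar>y\<bar> = th j" using s[of j] j th_pos[of j] i by auto
  moreover have "th j \<le> th 1" using th_antimono[of 1 j] j i by simp
  moreover have "th i \<le> th 1" using error_bounds(3)[OF i] j by simp
  ultimately show "th i \<le> \<bar>\<bar>x\<bar> - \<bar>y\<bar>\<bar>"
    using e[of c] c(2) error_bounds(2)[OF i] error_nonneg[of i] th_1_pos by linarith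
qed

lemma perturbed_sign:
  assumes e: "\<And>c. \<bar>e c\<bar> \<le> (2 ^ i - 1) * th 1" and c: "c \<in># seq_coeffs V"
  shows "0 < c + e c \<longleftrightarrow> 0 < c" "c + e c < 0 \<longleftrightarrow> c < 0"
proof -
  have "th 0 \<le> \<bar>c\<bar>" using spread_seq_coeffs[OF V] c by (simp add: spread_def)
  then show "0 < c + e c \<longleftrightarrow> 0 < c" "c + e c < 0 \<longleftrightarrow> c < 0"
    using e[of c] error_bounds(1)[OF i] th_pos[of i] i error_nonneg[of i] by auto
qed

text \<open>Cutting the cycle at its maximum \<open>M\<close> exposes the neighbours
  \<open>l\<close> and \<open>h\<close>. The coefficients \<open>M - l\<close> and
  \<open>h - M\<close> exceed all others in size; deletion merges them into their sum
  \<open>h - l\<close> and leaves \<open>D\<close> untouched. As \<open>4 * M2 \<le> M\<close>, both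
  \<open>p\<close> and \<open>q\<close> are of order \<open>M\<close>, while the other entries and
  \<open>p - q\<close> are at most of order \<open>M2\<close>.\<close>

lemma max_entries:
  fixes e s
  defines "M \<equiv> int (Max (set V))" and "M2 \<equiv> int (Max (set V - {Max (set V)}))"
  assumes e: "\<And>c. \<bar>e c\<bar> \<le> (2 ^ i - 1) * th 1" and s: "\<And>j. s j \<in> {1, -1}"
  obtains h l D p q Y where
    "seq_coeffs V = add_mset (M - l) (add_mset (h - M) D)"
    "seq_coeffs (del_max V) = add_mset (h - l) D"
    "p = M - l + e (M - l)" "- q = h - M + e (h - M)"
    "Y = image_mset (\<lambda>c. c + e c) D + image_mset (\<lambda>j. s j * th j) (mset [1..<Suc i])"
    "M \<le> 2 * p" "p \<le> M" "M \<le> 2 * q" "\<bar>p - q\<bar> \<le> 2 * M2" "0 < M"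
    "\<And>y. y \<in># Y \<Longrightarrow> \<bar>y\<bar> \<le> 2 * M2 \<and> -q < y \<and> y < p"
proof -
  have V0: "V \<noteq> []" using V(3) by auto
  obtain W where W: "seq_coeffs V = seq_coeffs (Max (set V) # W)" "seq_coeffs (del_max V) = seq_coeffs W"
    "distinct W" "set W = set V - {Max (set V)}" "length V = Suc (length W)"
    using rotate_to_max[OF V(1) V0] by metis
  have W0: "W \<noteq> []" using W(5) V(3) by auto
  have M2: "M2 = int (Max (set W))" by (simp add: M2_def W(4))
  have MS: "Max (set V) \<in> S" using V(2) V0 by (meson List.finite_set Max_in set_empty subsetD)
  have WS: "x \<in> S \<and> th 0 \<le> int x \<and> int x \<le> M2 \<and> 4 * int x \<le> M" if "x \<in> set W" for x
  proof -
    have x: "x \<in> set V" "x \<noteq> Max (set V)" using that W(4) by auto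
    then have "x < Max (set V)" by (meson List.finite_set Max_ge le_neq_implies_less)
    then have "4 * x \<le> Max (set V)" using gap[of x "Max (set V)"] x MS V(2) by blast
    then show ?thesis using x V(2) th_0_le[of x] that by (auto simp: M_def M2)
  qed
  have "Max (set W) \<in> set W" using W0 by simp
  from WS[OF this] have M: "4 * M2 \<le> M" "th 0 \<le> M2" by (auto simp: M2)
  define h l D where "h = int (hd W)" and "l = int (last W)" and "D = mset (path_diffs W)"
  have hl: "th 0 \<le> h" "h \<le> M2" "th 0 \<le> l" "l \<le> M2" using WS W0 by (auto simp: h_def l_def)
  define p q where "p = M - l + e (M - l)" and "q = M - h - e (h - M)"
  define Y where "Y = image_mset (\<lambda>c. c + e c) D + image_mset (\<lambda>j. s j * th j) (mset [1..<Suc i])"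
  note eb = error_bounds(2)[OF i] error_nonneg[of i] th_1_pos
  \<comment> \<open>Entries of \<open>D\<close> are differences of elements of \<open>W\<close>,
    which lie between 0 and \<open>M2\<close>; inserted values are at most \<open>th 1\<close>, far
    below \<open>th 0 \<le> M2\<close>.\<close>
  have yb: "\<bar>y\<bar> \<le> M2 + (2 ^ i - 1) * th 1" if y: "y \<in># Y" for y
  proof -
    from y consider c where "c \<in># D" "y = c + e c" | j where "1 \<le> j" "j \<le> i" "y = s j * th j"
      by (auto simp: Y_def less_Suc_eq_le simp del: upt_Suc)
    then show ?thesis
    proof cases
      case 1
      then obtain x z where xz: "x \<in> set W" "z \<in> set W" "c = int z - int x"
        using in_path_diffs W(3) by (metis D_def set_mset_mset)
      then have "\<bar>c\<bar> \<le> M2" using WS[OF xz(1)] WS[OF xz(2)] by auto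
      then show ?thesis using 1(2) e[of c] by linarith
    next
      case 2
      then have "\<bar>y\<bar> = th j" using s[of j] th_pos[of j] i by auto
      moreover have "th j \<le> th 1" using th_antimono[of 1 j] 2 i by simp
      ultimately show ?thesis using eb M(2) by linarith
    qed
  qed
  note ee = e[of "M - l"] e[of "h - M"]
  have pq: "M - M2 - (2 ^ i - 1) * th 1 \<le> p" "p \<le> M" "M - M2 - (2 ^ i - 1) * th 1 \<le> q"
    "\<bar>p - q\<bar> \<le> M2 + 2 * ((2 ^ i - 1) * th 1)"
    using ee hl eb unfolding p_def q_def by linarith+
  show thesis
  proof (rule that[of l h D p q Y])
    show "seq_coeffs V = add_mset (M - l) (add_mset (h - M) D)"
      using W0 unfolding W(1) by (simp add: seq_coeffs_path_diffs path_diffs_Cons M_def h_def l_def D_def)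
    show "seq_coeffs (del_max V) = add_mset (h - l) D"
      using W0 unfolding W(2) by (simp add: seq_coeffs_path_diffs h_def l_def D_def)
    show "M \<le> 2 * p" "M \<le> 2 * q" "\<bar>p - q\<bar> \<le> 2 * M2" "0 < M"
      using pq M eb by linarith+
    show "\<bar>y\<bar> \<le> 2 * M2 \<and> -q < y \<and> y < p" if "y \<in># Y" for y
      using yb[OF that] pq M eb by linarith
  qed (use pq in \<open>simp_all add: p_def q_def Y_def\<close>)
qed

context
  fixes X :: "int multiset"
  assumes X: "tracked th V i X"
begin

lemma spread_tracked: "spread (th i) X"
  using X spread_perturbed unfolding tracked_def by blast

lemma tracked_array:
  "is_array (signed_array X)" "distinct_array (signed_array X)" "invariant_array (signed_array X)"
  "th i \<le> delta (signed_array X)"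
proof -
  have X0: "X \<noteq> {#}" using X V(3) size_seq_coeffs[of V] unfolding tracked_def by fastforce
  show "is_array (signed_array X)" "distinct_array (signed_array X)" "th i \<le> delta (signed_array X)"
    using spread_array[OF spread_tracked] th_pos[of i] i X0 by auto
  show "invariant_array (signed_array X)"
    using X sum_signed_array[of X] unfolding tracked_def invariant_array_def by simp
qed

lemma theta_in_tracked:
  assumes "1 \<le> j" "j \<le> i"
  shows "th j \<in># entries (signed_array X)"
proof -
  obtain s where s: "\<forall>j. s j \<in> {1, -1}" "image_mset (\<lambda>j. s j * th j) (mset [1..<Suc i]) \<subseteq># X"
    using X unfolding tracked_def by auto
  have "j \<in># mset [1..<Suc i]" using assms by auto
  then have "s j * th j \<in># X" using mset_subset_eqD[OF s(2)] by auto
  moreover have "\<bar>s j * th j\<bar> = th j" using s(1) th_pos[of j] assms i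
    by (auto simp: abs_mult dest!: spec[of _ j])
  moreover have "0 \<notin># X" using spread_nonzero[OF spread_tracked] th_pos[of i] i by simp
  ultimately show ?thesis by (metis entries_signed_array image_eqI set_image_mset)
qed

text \<open>These are the inequalities from which feasibility follows. Members of
  \<open>Zset\<close> other than the difference of the maxima are sizes of elements of
  \<open>Y\<close>, hence controlled by the second largest element; the difference itself is bounded
  below by applying \<open>spread\<close> to the pair \<open>p\<close>, \<open>-q\<close>.\<close>

lemma tracked_bounds:
  shows "fst (signed_array X) \<noteq> {#}" "snd (signed_array X) \<noteq> {#}"
    "int (Max (set V)) \<le> 2 * max_pos (signed_array X)" "max_pos (signed_array X) \<le> int (Max (set V))"
    "\<bar>max_neg (signed_array X) - max_pos (signed_array X)\<bar> \<le> 2 * int (Max (set V - {Max (set V)}))"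
    "\<And>w. w \<in> Zset (signed_array X) \<Longrightarrow> th i \<le> w \<and> w \<le> 2 * int (Max (set V - {Max (set V)}))"
proof -
  obtain e s where e: "\<forall>c. \<bar>e c\<bar> \<le> (2 ^ i - 1) * th 1" and s: "\<forall>j. s j \<in> {1, -1}"
    and Xe: "X = image_mset (\<lambda>c. c + e c) (seq_coeffs V) + image_mset (\<lambda>j. s j * th j) (mset [1..<Suc i])"
    using X unfolding tracked_def by blast
  define M M2 where "M = int (Max (set V))" and "M2 = int (Max (set V - {Max (set V)}))"
  obtain h l D p q Y where *: "seq_coeffs V = add_mset (M - l) (add_mset (h - M) D)"
    "p = M - l + e (M - l)" "- q = h - M + e (h - M)"
    "Y = image_mset (\<lambda>c. c + e c) D + image_mset (\<lambda>j. s j * th j) (mset [1..<Suc i])"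
    "M \<le> 2 * p" "p \<le> M" "M \<le> 2 * q" "\<bar>p - q\<bar> \<le> 2 * M2" "0 < M"
    "\<And>y. y \<in># Y \<Longrightarrow> \<bar>y\<bar> \<le> 2 * M2 \<and> -q < y \<and> y < p"
    using max_entries[of e s thesis, folded M_def M2_def] e s by blast
  have XY: "X = add_mset p (add_mset (- q) Y)"
    unfolding Xe *(1) *(4) by (simp add: *(2,3) del: upt_Suc)
  have pq: "0 < p" "0 < q" using * by linarith+
  have mx: "max_pos (signed_array X) = p" "max_neg (signed_array X) = q"
    unfolding XY using max_signed_array[of p q Y] pq *(10) by blast+
  show "fst (signed_array X) \<noteq> {#}" "snd (signed_array X) \<noteq> {#}"
    using pq by (auto simp: XY signed_array_def)
  show "int (Max (set V)) \<le> 2 * max_pos (signed_array X)" "max_pos (signed_array X) \<le> int (Max (set V))"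
    "\<bar>max_neg (signed_array X) - max_pos (signed_array X)\<bar> \<le> 2 * int (Max (set V - {Max (set V)}))"
    unfolding mx M_def[symmetric] M2_def[symmetric] using * by auto
  note sp = spread_tracked
  fix w assume "w \<in> Zset (signed_array X)"
  then consider "w \<in> set_mset (entries (signed_array X))" "w \<noteq> p" "w \<noteq> q" | "w = \<bar>p - q\<bar>"
    by (auto simp: Zset_def mx entries_def)
  then have "th i \<le> w \<and> w \<le> 2 * M2"
  proof cases
    case 1
    then obtain x where x: "x \<in># X" "w = \<bar>x\<bar>"
      using entries_signed_array[OF spread_nonzero[OF sp]] th_pos[of i] i by auto
    then have "x \<in># Y" using 1 pq by (auto simp: XY)
    then show ?thesis using *(10)[of x] x sp by (simp add: spread_def)
  next
    case 2
    have "th i \<le> \<bar>\<bar>p\<bar> - \<bar>- q\<bar>\<bar>" using sp by (simp add: XY spread_def)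
    then show ?thesis using 2 pq *(8) by simp
  qed
  then show "th i \<le> w \<and> w \<le> 2 * int (Max (set V - {Max (set V)}))" by (simp add: M2_def)
qed

text \<open>Perturbation preserves signs and inserted values can only enlarge a side, so a
  non-monotonic sequence gives the two coefficients per side that ancestors require.\<close>

lemma tracked_sizes:
  "size (filter_mset (\<lambda>c. 0 < c) (seq_coeffs V)) \<le> size (fst (signed_array X))"
  "size (filter_mset (\<lambda>c. c < 0) (seq_coeffs V)) \<le> size (snd (signed_array X))"
proof -
  obtain e Z where e: "\<And>c. \<bar>e c\<bar> \<le> (2 ^ i - 1) * th 1" and
    Xe: "X = image_mset (\<lambda>c. c + e c) (seq_coeffs V) + Z"
    using X unfolding tracked_def by blast
  have "filter_mset (\<lambda>c. 0 < c + e c) (seq_coeffs V) = filter_mset (\<lambda>c. 0 < c) (seq_coeffs V)"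
    "filter_mset (\<lambda>c. c + e c < 0) (seq_coeffs V) = filter_mset (\<lambda>c. c < 0) (seq_coeffs V)"
    using perturbed_sign e by (auto intro!: filter_mset_cong)
  then show "size (filter_mset (\<lambda>c. 0 < c) (seq_coeffs V)) \<le> size (fst (signed_array X))"
    "size (filter_mset (\<lambda>c. c < 0) (seq_coeffs V)) \<le> size (snd (signed_array X))"
    by (simp_all add: Xe signed_array_def filter_mset_image_mset)
qed

text \<open>Once the inserted values are removed, \<open>c + e c\<close> is matched with
  \<open>c\<close>. Both have the same sign, so the matching respects the sides.\<close>

lemma tracked_approx:
  defines "B \<equiv> fold remove_coeff (map th [1..<Suc i]) (signed_array X)"
  defines "R \<equiv> \<lambda>x y. real_of_int \<bar>x - y\<bar> \<le> 2 ^ i * real_of_int (th 1)"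
  shows "rel_mset R (fst B) (fst (seq_array V)) \<and> rel_mset R (snd B) (snd (seq_array V))"
proof -
  obtain e s where e: "\<And>c. \<bar>e c\<bar> \<le> (2 ^ i - 1) * th 1" and s: "\<And>j. s j \<in> {1, -1}"
    and Xe: "X = image_mset (\<lambda>c. c + e c) (seq_coeffs V) + image_mset (\<lambda>j. s j * th j) (mset [1..<Suc i])"
    using X unfolding tracked_def by blast
  have "B = signed_array (image_mset (\<lambda>c. c + e c) (seq_coeffs V))"
    unfolding B_def Xe
  proof (rule fold_remove_coeff_signed_array[OF s])
    show "0 < th i" using th_pos i by simp
    show "0 < th j" if "j \<in> set [1..<Suc i]" for j using that th_pos i by auto
  qed (rule spread_tracked[unfolded Xe])
  moreover have "filter_mset (\<lambda>c. 0 < c + e c) (seq_coeffs V) = filter_mset (\<lambda>c. 0 < c) (seq_coeffs V)"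
    "filter_mset (\<lambda>c. c + e c < 0) (seq_coeffs V) = filter_mset (\<lambda>c. c < 0) (seq_coeffs V)"
    using perturbed_sign e by (auto intro!: filter_mset_cong)
  ultimately have B: "fst B = image_mset (\<lambda>c. c + e c) (filter_mset (\<lambda>c. 0 < c) (seq_coeffs V))"
    "snd B = image_mset (\<lambda>c. \<bar>c + e c\<bar>) (filter_mset (\<lambda>c. c < 0) (seq_coeffs V))"
    by (simp_all add: signed_array_def filter_mset_image_mset image_mset.compositionality comp_def)
  have R: "R x y" if "\<bar>x - y\<bar> \<le> \<bar>e c\<bar>" for x y c
  proof -
    have "\<bar>x - y\<bar> \<le> 2 ^ i * th 1" using that e[of c] th_1_pos by (simp add: algebra_simps)
    then have "real_of_int \<bar>x - y\<bar> \<le> real_of_int (2 ^ i * th 1)" by (simp only: of_int_le_iff)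
    then show ?thesis by (simp add: R_def)
  qed
  have "rel_mset R (fst B) (image_mset (\<lambda>c. c) (filter_mset (\<lambda>c. 0 < c) (seq_coeffs V)))"
    unfolding B
  proof (rule rel_mset_image, rule R)
    fix c show "\<bar>c + e c - c\<bar> \<le> \<bar>e c\<bar>" by simp
  qed
  moreover have "rel_mset R (snd B) (image_mset abs (filter_mset (\<lambda>c. c < 0) (seq_coeffs V)))"
    unfolding B
  proof (rule rel_mset_image, rule R)
    fix c show "\<bar>\<bar>c + e c\<bar> - \<bar>c\<bar>\<bar> \<le> \<bar>e c\<bar>" by linarith
  qed
  ultimately show ?thesis by (simp add: seq_array_def)
qed

end
end

text \<open>\<open>p - q\<close> is \<open>h - l\<close> up to the two old errors. So for either
  sign \<open>r\<close> prescribed by the type, the new coefficient is a perturbation of the one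
  created by deleting the maximum.\<close>

lemma tracked_step:
  assumes V: "distinct V" "set V \<subseteq> S" "4 \<le> length V" and i: "i < n" and X: "tracked th V i X"
  shows "\<exists>X'. tracked th (del_max V) (Suc i) X' \<and>
    anc_array ty (th (Suc i)) (signed_array X) = signed_array X'"
proof -
  obtain e s where e: "\<forall>c. \<bar>e c\<bar> \<le> (2 ^ i - 1) * th 1" and s: "\<forall>j. s j \<in> {1, -1}"
    and sum: "sum_mset X = 0"
    and Xe: "X = image_mset (\<lambda>c. c + e c) (seq_coeffs V) + image_mset (\<lambda>j. s j * th j) (mset [1..<Suc i])"
    using X unfolding tracked_def by blast
  define \<theta> where "\<theta> = th (Suc i)"
  define M M2 where "M = int (Max (set V))" and "M2 = int (Max (set V - {Max (set V)}))"
  have "3 \<le> length V" "i \<le> n" using V(3) i by auto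
  then obtain h l D p q Y where *: "seq_coeffs V = add_mset (M - l) (add_mset (h - M) D)"
    "seq_coeffs (del_max V) = add_mset (h - l) D"
    "p = M - l + e (M - l)" "- q = h - M + e (h - M)"
    "Y = image_mset (\<lambda>c. c + e c) D + image_mset (\<lambda>j. s j * th j) (mset [1..<Suc i])"
    "M \<le> 2 * p" "M \<le> 2 * q" "0 < M"
    "\<And>y. y \<in># Y \<Longrightarrow> \<bar>y\<bar> \<le> 2 * M2 \<and> -q < y \<and> y < p"
    using max_entries[OF V(1,2), of i e s thesis, folded M_def M2_def] e s by blast
  have XY: "X = add_mset p (add_mset (- q) Y)"
    unfolding Xe *(1) *(5) by (simp add: *(3,4) del: upt_Suc)
  have pq: "0 < p" "0 < q" using * by linarith+
  have "V \<noteq> []" using V(3) by auto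
  then have dV: "distinct (del_max V)" "set (del_max V) \<subseteq> S" "3 \<le> length (del_max V)"
    using del_max_facts[of V] V by auto
  have sp: "spread (th 0) (seq_coeffs (del_max V))" using spread_seq_coeffs dV by blast
  have th: "th 0 \<le> \<bar>h - l\<bar>" using sp by (simp add: *(2) spread_def)
  have hD: "h - l \<notin># D" using sp th_pos[of 0] by (force simp: *(2) spread_def)
  have \<theta>: "0 < \<theta>" "\<theta> \<le> th 1" using th_pos[of "Suc i"] th_antimono[of 1 "Suc i"] i by (auto simp: \<theta>_def)
  \<comment> \<open>\<open>h - l\<close> is a coefficient of the shortened sequence, hence of size
    at least \<open>th 0\<close>; this leaves room for \<theta> below
    \<open>|p - q|\<close>.\<close>
  have "\<bar>p - q\<bar> \<ge> \<bar>h - l\<bar> - 2 * ((2 ^ i - 1) * th 1)"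
    using e[rule_format, of "M - l"] e[rule_format, of "h - M"] *(3,4) by linarith
  then have "\<theta> < \<bar>p - q\<bar>"
    using th \<theta> error_bounds(2)[of i] error_nonneg[of i] i by linarith
  then obtain r where r: "r \<in> {1, -1}" and
    anc: "anc_array ty \<theta> (signed_array X) = signed_array (add_mset (p - q - r * \<theta>) (add_mset (r * \<theta>) Y))"
    using anc_signed_array[of p q Y \<theta> ty] pq *(9) \<theta>(1) unfolding XY by blast
  \<comment> \<open>Changing \<open>e\<close> at the value \<open>h - l\<close> does not disturb the
    other errors, as this value does not occur in \<open>D\<close>; likewise \<open>Suc i\<close> is
    a fresh index for \<open>s\<close>.\<close>
  define e' s' where "e' = e(h - l := e (M - l) + e (h - M) - r * \<theta>)" and "s' = s(Suc i := r)"
  define X' where "X' = add_mset (p - q - r * \<theta>) (add_mset (r * \<theta>) Y)"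
  have "tracked th (del_max V) (Suc i) X'" unfolding tracked_def
  proof (intro conjI exI)
    show "sum_mset X' = 0" using sum by (simp add: X'_def XY)
    show "\<forall>j. s' j \<in> {1, -1}" using s r by (simp add: s'_def)
    show "\<forall>c. \<bar>e' c\<bar> \<le> (2 ^ Suc i - 1) * th 1"
    proof
      fix c
      have E: "(2 ^ Suc i - 1) * th 1 = 2 * ((2 ^ i - 1) * th 1) + th 1" by (simp add: algebra_simps)
      have "\<bar>e (M - l) + e (h - M) - r * \<theta>\<bar> \<le> 2 * ((2 ^ i - 1) * th 1) + th 1"
        using e[rule_format, of "M - l"] e[rule_format, of "h - M"] r \<theta> by auto
      moreover have "\<bar>e c\<bar> \<le> 2 * ((2 ^ i - 1) * th 1) + th 1"
        using e[rule_format, of c] error_nonneg[of i] th_1_pos by linarith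
      ultimately show "\<bar>e' c\<bar> \<le> (2 ^ Suc i - 1) * th 1" unfolding E by (simp add: e'_def)
    qed
    have "image_mset (\<lambda>c. c + e' c) D = image_mset (\<lambda>c. c + e c) D"
      using hD by (intro image_mset_cong) (auto simp: e'_def)
    moreover have "image_mset (\<lambda>j. s' j * th j) (mset [1..<Suc i]) = image_mset (\<lambda>j. s j * th j) (mset [1..<Suc i])"
      by (intro image_mset_cong) (auto simp: s'_def)
    moreover have "mset [1..<Suc (Suc i)] = add_mset (Suc i) (mset [1..<Suc i])" by simp
    moreover have "p - q - r * \<theta> = h - l + e' (h - l)" using *(3,4) by (simp add: e'_def)
    moreover have "r * \<theta> = s' (Suc i) * th (Suc i)" by (simp add: s'_def \<theta>_def)
    ultimately show "X' = image_mset (\<lambda>c. c + e' c) (seq_coeffs (del_max V)) +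
        image_mset (\<lambda>j. s' j * th j) (mset [1..<Suc (Suc i)])"
      unfolding X'_def *(2,5) by (simp del: upt_Suc mset_upt)
  qed
  then show ?thesis using anc unfolding X'_def \<theta>_def by blast
qed

lemma tracked_iterate:
  assumes U: "distinct U" "set U \<subseteq> S" "U \<noteq> []"
    and nm: "\<And>j. j < n \<Longrightarrow> \<not> monotonic ((del_max ^^ j) U)" and len: "3 \<le> length U"
    and A: "A 0 = seq_array U" "\<And>j. j < n \<Longrightarrow> A (Suc j) = anc_array (ty j) (th (Suc j)) (A j)"
    and i: "i \<le> n"
  shows "distinct ((del_max ^^ i) U) \<and> set ((del_max ^^ i) U) \<subseteq> S \<and> 3 \<le> length ((del_max ^^ i) U) \<and>
    (\<exists>X. tracked th ((del_max ^^ i) U) i X \<and> A i = signed_array X)"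
  using i
proof (induction i)
  case 0
  then show ?case using U len A(1) tracked_0[OF U(3)] by (auto simp: seq_array_signed)
next
  case (Suc i)
  define V where "V = (del_max ^^ i) U"
  obtain X where V: "distinct V" "set V \<subseteq> S" "3 \<le> length V" and X: "tracked th V i X" "A i = signed_array X"
    using Suc unfolding V_def by auto
  \<comment> \<open>Non-monotonicity supplies a fourth element, so that deletion still leaves the
    three needed for distinct coefficients.\<close>
  have V4: "4 \<le> length V" using non_monotonic_sizes(3)[OF V(1)] nm[of i] Suc.prems by (simp add: V_def)
  obtain X' where "tracked th (del_max V) (Suc i) X'" "A (Suc i) = signed_array X'"
    using tracked_step[OF V(1,2) V4 _ X(1)] A(2)[of i] X(2) Suc.prems by fastforce
  moreover have "V \<noteq> []" using V4 by auto
  then have "set (del_max V) \<subseteq> S" "distinct (del_max V)" "length (del_max V) = length V - 1"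
    using del_max_facts[of V] V by auto
  ultimately show ?case using V4 by (auto simp: V_def)
qed

end


section \<open>Asymptotics\<close>

lemma log_real_at_top: "filterlim (\<lambda>m::nat. log 2 (real m)) at_top at_top"
proof -
  have "filterlim (\<lambda>m::nat. ln (real m) * inverse (ln 2)) at_top at_top"
    by (intro filterlim_at_top_mult_tendsto_pos[OF tendsto_const]
        filterlim_compose[OF ln_at_top] filterlim_real_sequentially) simp
  then show ?thesis by (simp add: log_def divide_inverse)
qed

lemma powr_at_top:
  assumes "0 < (e::real)"
  shows "filterlim (\<lambda>x::real. x powr e) at_top at_top"
  unfolding filterlim_at_top
proof
  fix Z :: real
  show "\<forall>\<^sub>F x in at_top. Z \<le> x powr e"
    using eventually_ge_at_top[of "\<bar>Z\<bar> powr (1 / e)"]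
  proof eventually_elim
    case (elim x)
    then have "(\<bar>Z\<bar> powr (1 / e)) powr e \<le> x powr e" using assms by (intro powr_mono2) auto
    then show ?case using assms by (simp add: powr_powr)
  qed
qed

text \<open>Division by \<open>L\<close> leaves \<open>C * L^(a-1) + K / L\<close>, which tends to
  0. With logarithms for \<open>L\<close>, this is the source of sparseness:
  \<open>log x \<le> C * log^a y\<close> forces \<open>2^K * x \<le> y\<close> for large
  \<open>y\<close>.\<close>

lemma powr_sublinear:
  fixes a C K :: real
  assumes "a < 1"
  shows "\<forall>\<^sub>F L in at_top. C * L powr a + K \<le> L"
proof -
  have "((\<lambda>L::real. L powr (a - 1)) \<longlongrightarrow> 0) at_top"
    using assms by (intro tendsto_neg_powr filterlim_ident) simp
  then have "((\<lambda>L::real. C * L powr (a - 1) + K * inverse L) \<longlongrightarrow> C * 0 + K * 0) at_top"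
    by (intro tendsto_intros tendsto_inverse_0_at_top filterlim_ident)
  then have "\<forall>\<^sub>F L in at_top. C * L powr (a - 1) + K * inverse L < 1"
    by (rule order_tendstoD) simp
  then show ?thesis using eventually_gt_at_top[of 0]
  proof eventually_elim
    case (elim L)
    then have "(C * L powr (a - 1) + K * inverse L) * L \<le> 1 * L" by (intro mult_right_mono) auto
    then show ?case using elim by (simp add: powr_diff field_simps)
  qed
qed

lemma filterlim_powr_log:
  assumes "0 < c" "0 < e"
  shows "filterlim (\<lambda>m::nat. c * log 2 (real m) powr e) at_top at_top"
proof -
  have "filterlim (\<lambda>m::nat. log 2 (real m) powr e) at_top at_top"
    using filterlim_compose[OF _ log_real_at_top, of "\<lambda>x. x powr e"] powr_at_top assms(2) by blast
  then show ?thesis using assms(1) by (intro filterlim_tendsto_pos_mult_at_top[OF tendsto_const])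
qed

section \<open>Plastic sets: uniform logarithmic bounds\<close>

lemma plastic_log_bounds:
  assumes "plastic a b t R"
  obtains c C where "0 < c" "0 < C"
    "\<forall>\<^sub>F m in at_top. \<forall>x\<in>R m. 1 \<le> x \<and>
       c * log 2 (real m) powr b \<le> log 2 (real x) \<and> log 2 (real x) \<le> C * log 2 (real m) powr a"
proof -
  define el where "el = (\<lambda>i m. real (sorted_list_of_set (R m) ! (i - 1)))"
  have t: "0 < t" and R: "\<forall>\<^sub>F m in at_top. R m \<subseteq> {1..m} \<and> card (R m) = t"
    and lo: "(\<lambda>m. log 2 (el 1 m)) \<in> \<Omega>(\<lambda>m. log 2 (real m) powr b)"
    and up: "(\<lambda>m. log 2 (el t m)) \<in> O(\<lambda>m. log 2 (real m) powr a)"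
    using assms by (auto simp: plastic_def el_def Let_def)
  obtain c where c: "c > 0" "\<forall>\<^sub>F m in at_top. norm (log 2 (el 1 m)) \<ge> c * norm (log 2 (real m) powr b)"
    using lo by (rule landau_omega.bigE)
  obtain C where C: "C > 0" "\<forall>\<^sub>F m in at_top. norm (log 2 (el t m)) \<le> C * norm (log 2 (real m) powr a)"
    using up by (rule landau_o.bigE)
  have "\<forall>\<^sub>F m in at_top. \<forall>x\<in>R m. 1 \<le> x \<and>
       c * log 2 (real m) powr b \<le> log 2 (real x) \<and> log 2 (real x) \<le> C * log 2 (real m) powr a"
    using R c(2) C(2)
  proof eventually_elim
    case (elim m)
    define xs where "xs = sorted_list_of_set (R m)"
    have fin: "finite (R m)" using elim finite_subset by blast
    then have xs: "set xs = R m" "sorted xs" "length xs = t" using elim by (simp_all add: xs_def)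
    have pos: "1 \<le> y" if "y \<in> R m" for y using that elim by auto
    show ?case
    proof
      fix x assume x: "x \<in> R m"
      then obtain i where i: "i < t" "x = xs ! i" using xs by (metis in_set_conv_nth)
      have "xs ! 0 \<le> x" "x \<le> xs ! (t - 1)" using i xs t by (auto intro!: sorted_nth_mono)
      moreover have "1 \<le> xs ! 0" using pos xs t by (metis nth_mem)
      ultimately have "0 \<le> log 2 (el 1 m)" "log 2 (el 1 m) \<le> log 2 (real x)" "log 2 (real x) \<le> log 2 (el t m)"
        by (simp_all add: el_def xs_def)
      then show "1 \<le> x \<and> c * log 2 (real m) powr b \<le> log 2 (real x) \<and> log 2 (real x) \<le> C * log 2 (real m) powr a"
        using elim pos[OF x] by simp
    qed
  qed
  then show thesis using that c C by blast
qed

text \<open>Plasticity relates neighbours only; monotonicity of \<open>log^a\<close> extends this to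
  all pairs, since \<open>y\<close> is at least the successor of \<open>x\<close>. The constant
  \<open>G\<close> dominates the constants of all neighbouring pairs, and its summand 1 keeps it
  positive for \<open>t = 1\<close>.\<close>

lemma plastic_log_gap:
  assumes "plastic a b t R" "0 \<le> a"
  obtains G where "0 < G"
    "\<forall>\<^sub>F m in at_top. \<forall>x\<in>R m. \<forall>y\<in>R m. x < y \<longrightarrow> log 2 (real x) \<le> G * log 2 (real y) powr a"
proof -
  define el where "el = (\<lambda>i m. real (sorted_list_of_set (R m) ! (i - 1)))"
  have R: "\<forall>\<^sub>F m in at_top. R m \<subseteq> {1..m} \<and> card (R m) = t"
    and st: "\<forall>i\<in>{1..<t}. (\<lambda>m. log 2 (el i m)) \<in> O(\<lambda>m. log 2 (el (i + 1) m) powr a)"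
    using assms(1) by (auto simp: plastic_def el_def Let_def)
  have "\<forall>i\<in>{1..<t}. \<exists>C>0. \<forall>\<^sub>F m in at_top. norm (log 2 (el i m)) \<le> C * norm (log 2 (el (i + 1) m) powr a)"
    using st by (blast elim: landau_o.bigE)
  then obtain C where C: "\<And>i. i \<in> {1..<t} \<Longrightarrow> C i > 0"
    "\<And>i. i \<in> {1..<t} \<Longrightarrow> \<forall>\<^sub>F m in at_top. norm (log 2 (el i m)) \<le> C i * norm (log 2 (el (i + 1) m) powr a)"
    by metis
  define G where "G = 1 + (\<Sum>i\<in>{1..<t}. C i)"
  have G: "C i \<le> G" if "i \<in> {1..<t}" for i
    using member_le_sum[of i "{1..<t}" C] C(1) that unfolding G_def by (force simp: less_imp_le)
  have G0: "0 < G" unfolding G_def using C(1) by (intro add_pos_nonneg sum_nonneg) (auto simp: less_imp_le)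
  have "\<forall>\<^sub>F m in at_top. \<forall>i\<in>{1..<t}. norm (log 2 (el i m)) \<le> C i * norm (log 2 (el (i + 1) m) powr a)"
    using C(2) by (intro eventually_ball_finite) auto
  with R have "\<forall>\<^sub>F m in at_top. \<forall>x\<in>R m. \<forall>y\<in>R m. x < y \<longrightarrow> log 2 (real x) \<le> G * log 2 (real y) powr a"
  proof eventually_elim
    case (elim m)
    define xs where "xs = sorted_list_of_set (R m)"
    have fin: "finite (R m)" using elim finite_subset by blast
    then have xs: "set xs = R m" "sorted xs" "length xs = t" using elim by (simp_all add: xs_def)
    have pos: "1 \<le> y" if "y \<in> R m" for y using that elim by auto
    show ?case
    proof (intro ballI impI)
      fix x y assume x: "x \<in> R m" and y: "y \<in> R m" and "x < y"
      obtain i where i: "i < t" "x = xs ! i" using x xs by (metis in_set_conv_nth)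
      obtain j where j: "j < t" "y = xs ! j" using y xs by (metis in_set_conv_nth)
      have ij: "i < j" using \<open>x < y\<close> i j xs by (metis not_le sorted_nth_mono)
      then have le: "xs ! Suc i \<le> y" using j xs by (auto intro!: sorted_nth_mono)
      have S: "1 \<le> xs ! Suc i" using pos xs ij j by (metis nth_mem less_trans_Suc)
      have iS: "Suc i \<in> {1..<t}" using ij j by simp
      have "log 2 (real x) \<le> C (Suc i) * log 2 (real (xs ! Suc i)) powr a"
        using elim(2) iS pos[OF x] by (force simp: el_def xs_def i)
      also have "\<dots> \<le> G * log 2 (real y) powr a"
        using G[OF iS] G0 S le assms(2) C(1)[OF iS] by (intro mult_mono powr_mono2) auto
      finally show "log 2 (real x) \<le> G * log 2 (real y) powr a" .
    qed
  qed
  then show thesis using that G0 by blast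
qed

text \<open>For even \<open>t\<close> the condition \<open>0 < a ^ t\<close> alone would admit negative \<open>a\<close>.\<close>

lemma plastic_exponent_pos:
  assumes "plastic a b t R" "0 < b" "0 < a ^ t"
  shows "0 < a"
proof (rule ccontr)
  assume "\<not> 0 < a"
  \<comment> \<open>For \<open>a \<le> 0\<close> the upper bound on the logarithms is at most
    \<open>C\<close> once \<open>log m\<close> reaches 1, whereas the lower bound tends to infinity
    because \<open>b > 0\<close>.\<close>
  obtain c C where c: "0 < c" "0 < C" and ev: "\<forall>\<^sub>F m in at_top. \<forall>x\<in>R m. 1 \<le> x \<and>
       c * log 2 (real m) powr b \<le> log 2 (real x) \<and> log 2 (real x) \<le> C * log 2 (real m) powr a"
    by (rule plastic_log_bounds[OF assms(1)])
  have t: "0 < t" "\<forall>\<^sub>F m in at_top. R m \<subseteq> {1..m} \<and> card (R m) = t" using assms(1) by (auto simp: plastic_def)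
  have "\<forall>\<^sub>F m::nat in at_top. C < c * log 2 (real m) powr b"
    using filterlim_powr_log[OF c(1) assms(2)] by (simp add: filterlim_at_top_dense)
  moreover have "\<forall>\<^sub>F m::nat in at_top. 1 \<le> log 2 (real m)"
    using log_real_at_top by (simp add: filterlim_at_top)
  ultimately have "\<forall>\<^sub>F m::nat in at_top. False" using ev t(2)
  proof eventually_elim
    case (elim m)
    have "R m \<noteq> {}" using elim t(1) by auto
    then obtain x where "x \<in> R m" by blast
    then have "C < C * log 2 (real m) powr a" using elim(1,3) by fastforce
    moreover have "log 2 (real m) powr a \<le> log 2 (real m) powr 0"
      using elim(2) \<open>\<not> 0 < a\<close> by (intro powr_mono) auto
    ultimately show False using c(2) elim(2) by simp
  qed
  then show False by simp
qed

text \<open>The number rounded down is at least 2, so rounding costs at most a factor 2, that is, 1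
  in the logarithm.\<close>

lemma theta_Suc_bounds:
  assumes "0 < theta a U j" "1 \<le> log 2 (real_of_int (theta a U j)) powr a"
  shows "0 < theta a U (Suc j)"
    and "real_of_int (theta a U (Suc j)) \<le> 2 powr (log 2 (real_of_int (theta a U j)) powr a)"
    and "log 2 (real_of_int (theta a U j)) powr a - 1 \<le> log 2 (real_of_int (theta a U (Suc j)))"
proof -
  define e where "e = log 2 (real_of_int (theta a U j)) powr a"
  have e: "2 \<le> (2::real) powr e" using assms(2) powr_mono[of 1 e "2::real"] by (simp add: e_def)
  then have *: "2 powr e / 2 \<le> real_of_int \<lfloor>2 powr e\<rfloor>" by linarith
  show pos: "0 < theta a U (Suc j)" using e by (simp add: e_def[symmetric])
  show "real_of_int (theta a U (Suc j)) \<le> 2 powr e" by (simp add: e_def[symmetric])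
  have "log 2 (2 powr (e - 1)) \<le> log 2 (real_of_int \<lfloor>2 powr e\<rfloor>)"
    using * e by (intro log_mono) (auto simp: powr_diff)
  then show "e - 1 \<le> log 2 (real_of_int (theta a U (Suc j)))" by (simp add: e_def[symmetric])
qed

text \<open>Raising to the power \<open>a\<close> multiplies the exponent by \<open>a\<close> at
  each step. The constant passes from \<open>c\<close> to \<open>c^a / 2\<close>, the half absorbing
  the loss of 1 from rounding as soon as the main term is at least 2.\<close>

lemma theta_growth:
  fixes U :: "nat \<Rightarrow> nat list"
  assumes "0 < a" "0 < b" "0 < c"
    and "\<forall>\<^sub>F m in at_top. 0 < Min (set (U m)) \<and> c * log 2 (real m) powr b \<le> log 2 (real (Min (set (U m))))"
  shows "\<exists>c>0. \<forall>\<^sub>F m in at_top. 0 < theta a (U m) j \<and>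
    c * log 2 (real m) powr (b * a ^ j) \<le> log 2 (real_of_int (theta a (U m) j))"
proof (induction j)
  case 0
  then show ?case using assms(3,4) by auto
next
  case (Suc j)
  then obtain c where c: "0 < c" "\<forall>\<^sub>F m in at_top. 0 < theta a (U m) j \<and>
    c * log 2 (real m) powr (b * a ^ j) \<le> log 2 (real_of_int (theta a (U m) j))" by blast
  have e: "0 < c powr a" "0 < b * a ^ Suc j" using c(1) assms by auto
  have "\<forall>\<^sub>F m::nat in at_top. 2 \<le> c powr a * log 2 (real m) powr (b * a ^ Suc j)"
    using filterlim_powr_log[OF e] by (simp add: filterlim_at_top)
  with c(2) have "\<forall>\<^sub>F m in at_top. 0 < theta a (U m) (Suc j) \<and>
    (c powr a / 2) * log 2 (real m) powr (b * a ^ Suc j) \<le> log 2 (real_of_int (theta a (U m) (Suc j)))"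
  proof eventually_elim
    case (elim m)
    have "(c * log 2 (real m) powr (b * a ^ j)) powr a \<le> log 2 (real_of_int (theta a (U m) j)) powr a"
      using elim assms c by (intro powr_mono2) auto
    then have *: "c powr a * log 2 (real m) powr (b * a ^ Suc j) \<le> log 2 (real_of_int (theta a (U m) j)) powr a"
      using c(1) by (simp add: powr_mult powr_powr mult_ac)
    then show ?case using theta_Suc_bounds[of a "U m" j] elim by auto
  qed
  then show ?case using e by (intro exI[of _ "c powr a / 2"]) simp
qed

text \<open>\<open>M\<close> and \<open>N\<close> stand for the largest and second largest element
  of a sequence. From \<open>log N \<le> G * log^a M\<close> and \<open>a < 1\<close> follows
  \<open>N = o(M)\<close>; bounds in terms of \<open>M\<close> carry over to \<open>max_pos\<close>,
  which lies between \<open>M / 2\<close> and \<open>M\<close>.\<close>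

lemma feasibleI_bounds:
  fixes A :: "nat \<Rightarrow> arr" and M N \<theta> :: "nat \<Rightarrow> int"
  assumes a: "0 < a" "a < 1" and b': "0 < b'" "b' < 1" and "0 < c" "0 < C" "0 < G"
    and ev: "\<forall>\<^sub>F m in at_top. fst (A m) \<noteq> {#} \<and> snd (A m) \<noteq> {#} \<and>
        is_array (A m) \<and> invariant_array (A m) \<and> distinct_array (A m) \<and>
        M m \<le> 2 * max_pos (A m) \<and> max_pos (A m) \<le> M m \<and>
        \<bar>max_neg (A m) - max_pos (A m)\<bar> \<le> 2 * N m \<and> (\<forall>w\<in>Zset (A m). \<theta> m \<le> w \<and> w \<le> 2 * N m)"
    and \<theta>: "\<forall>\<^sub>F m in at_top. 0 < \<theta> m \<and> c * log 2 (real m) powr b' \<le> log 2 (real_of_int (\<theta> m))"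
    and M: "\<forall>\<^sub>F m in at_top. 0 < N m \<and> 0 < M m \<and>
        log 2 (real_of_int (N m)) \<le> G * log 2 (real_of_int (M m)) powr a \<and>
        log 2 (real_of_int (M m)) \<le> C * log 2 (real m) powr a"
    and Mtop: "filterlim (\<lambda>m. log 2 (real_of_int (M m))) at_top at_top"
  shows "feasible a b' A"
proof -
  have ratio: "\<forall>\<^sub>F m in at_top. K * real_of_int (N m) \<le> real_of_int (M m)" if K: "0 < K" for K
  proof -
    have "\<forall>\<^sub>F m in at_top. G * log 2 (real_of_int (M m)) powr a + log 2 K \<le> log 2 (real_of_int (M m))"
      using powr_sublinear[OF a(2)] Mtop by (rule eventually_compose_filterlim)
    with M show ?thesis
    proof eventually_elim
      case (elim m)
      then have "log 2 (K * real_of_int (N m)) \<le> log 2 (real_of_int (M m))"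
        using K by (simp add: log_mult)
      then show ?case using elim K by simp
    qed
  qed
  \<comment> \<open>With \<open>log M\<close> at least 2, subtracting 1 for the factor 2 between
    \<open>M\<close> and \<open>max_pos\<close> still leaves half of \<open>log M\<close>.\<close>
  have large: "\<forall>\<^sub>F m in at_top. 2 \<le> log 2 (real_of_int (M m))"
    using Mtop by (simp add: filterlim_at_top)
  have mp: "\<forall>\<^sub>F m in at_top. 0 < max_pos (A m) \<and>
      log 2 (real_of_int (M m)) / 2 \<le> log 2 (real_of_int (max_pos (A m))) \<and>
      log 2 (real_of_int (max_pos (A m))) \<le> log 2 (real_of_int (M m))"
    using ev M large
  proof eventually_elim
    case (elim m)
    then have pos: "0 < max_pos (A m)" by simp
    have "log 2 (real_of_int (M m)) \<le> log 2 (2 * real_of_int (max_pos (A m)))"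
      using elim by (intro log_mono) linarith+
    also have "\<dots> = 1 + log 2 (real_of_int (max_pos (A m)))" using pos by (simp add: log_mult)
    finally show ?case using elim pos by simp
  qed
  show ?thesis unfolding feasible_def
  proof (intro conjI)
    show "\<forall>\<^sub>F m in at_top. fst (A m) \<noteq> {#} \<and> snd (A m) \<noteq> {#} \<and>
        is_array (A m) \<and> invariant_array (A m) \<and> distinct_array (A m)"
      using ev by eventually_elim blast
    show "(\<lambda>m. real_of_int \<bar>max_neg (A m) - max_pos (A m)\<bar>) \<in> o(\<lambda>m. real_of_int (max_pos (A m)))"
    proof (rule landau_o.smallI)
      \<comment> \<open>The ratio \<open>4 / k\<close> is chosen so that
        \<open>2 * N \<le> k * (M / 2) \<le> k * max_pos\<close>.\<close>
      fix k :: real assume k: "0 < k"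
      have "\<forall>\<^sub>F m in at_top. 4 / k * real_of_int (N m) \<le> real_of_int (M m)"
        using ratio[of "4 / k"] k by simp
      with ev mp show "\<forall>\<^sub>F m in at_top. norm (real_of_int \<bar>max_neg (A m) - max_pos (A m)\<bar>)
          \<le> k * norm (real_of_int (max_pos (A m)))"
      proof eventually_elim
        case (elim m)
        have "real_of_int \<bar>max_neg (A m) - max_pos (A m)\<bar> \<le> 2 * real_of_int (N m)"
          using elim(1) by linarith
        also have "\<dots> \<le> k * (real_of_int (M m) / 2)" using elim(3) k by (simp add: field_simps)
        also have "\<dots> \<le> k * real_of_int (max_pos (A m))"
          using elim(1) k by (intro mult_left_mono) linarith+
        finally show ?case using elim(2) by simp
      qed
    qed
    show "(\<lambda>m. log 2 (real_of_int (max_pos (A m)))) \<in> O(\<lambda>m. log 2 (real m) powr a)"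
    proof (rule bigoI)
      show "\<forall>\<^sub>F m in at_top. norm (log 2 (real_of_int (max_pos (A m)))) \<le> C * norm (log 2 (real m) powr a)"
        using mp M large by eventually_elim simp
    qed
    show "\<exists>c>0. \<exists>C>0. \<forall>\<^sub>F m in at_top. \<forall>w\<in>Zset (A m).
        c * log 2 (real m) powr b' \<le> log 2 (real_of_int w) \<and>
        log 2 (real_of_int w) \<le> C * log 2 (real_of_int (max_pos (A m))) powr a"
    proof (intro exI conjI)
      \<comment> \<open>The factor 2 in \<open>w \<le> 2 * N\<close> adds 1 to the logarithm, which
        turns \<open>G\<close> into \<open>1 + G\<close>; \<open>2 powr a\<close> is the price of
        replacing \<open>log M\<close> by \<open>2 * log max_pos\<close>.\<close>
      show "0 < c" "0 < (1 + G) * 2 powr a" using assms by auto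
      show "\<forall>\<^sub>F m in at_top. \<forall>w\<in>Zset (A m). c * log 2 (real m) powr b' \<le> log 2 (real_of_int w) \<and>
        log 2 (real_of_int w) \<le> (1 + G) * 2 powr a * log 2 (real_of_int (max_pos (A m))) powr a"
        using ev mp M large \<theta>
      proof eventually_elim
        case (elim m)
        define L where "L = log 2 (real_of_int (M m))"
        have "L powr a \<le> (2 * log 2 (real_of_int (max_pos (A m)))) powr a"
          using elim a by (intro powr_mono2) (auto simp: L_def)
        also have "\<dots> = 2 powr a * log 2 (real_of_int (max_pos (A m))) powr a"
          using elim by (intro powr_mult)
        finally have Lp: "L powr a \<le> 2 powr a * log 2 (real_of_int (max_pos (A m))) powr a" .
        show ?case
        proof
          fix w assume "w \<in> Zset (A m)"
          then have w: "\<theta> m \<le> w" "w \<le> 2 * N m" using elim by blast+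
          have "log 2 (real_of_int (\<theta> m)) \<le> log 2 (real_of_int w)"
            using w elim by (intro log_mono) auto
          then have 1: "c * log 2 (real m) powr b' \<le> log 2 (real_of_int w)" using elim by linarith
          have "log 2 (real_of_int w) \<le> log 2 (2 * real_of_int (N m))"
            using w elim by (intro log_mono) linarith+
          also have "\<dots> = 1 + log 2 (real_of_int (N m))" using elim by (simp add: log_mult)
          also have "\<dots> \<le> 1 + G * L powr a" using elim by (simp add: L_def)
          also have "\<dots> \<le> (1 + G) * L powr a"
          proof -
            have "1 \<le> L powr a" using elim(4) a by (intro ge_one_powr_ge_zero) (auto simp: L_def)
            then show ?thesis by (simp add: algebra_simps)
          qed
          also have "\<dots> \<le> (1 + G) * (2 powr a * log 2 (real_of_int (max_pos (A m))) powr a)"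
            using Lp assms by (intro mult_left_mono) auto
          finally show "c * log 2 (real m) powr b' \<le> log 2 (real_of_int w) \<and>
            log 2 (real_of_int w) \<le> (1 + G) * 2 powr a * log 2 (real_of_int (max_pos (A m))) powr a"
            using 1 by (simp add: mult_ac)
        qed
      qed
    qed
  qed (use a b' in auto)
qed

section \<open>Sequences drawn from a plastic set\<close>

locale plastic_family =
  fixes a b c C G :: real and R :: "nat \<Rightarrow> nat set" and U :: "nat \<Rightarrow> nat list"
  assumes a: "0 < a" "a < 1" and b: "0 < b" "b < 1" and constants_pos: "0 < c" "0 < C" "0 < G"
    and log_bounds: "\<forall>\<^sub>F m in at_top. \<forall>x\<in>R m. 1 \<le> x \<and>
       c * log 2 (real m) powr b \<le> log 2 (real x) \<and> log 2 (real x) \<le> C * log 2 (real m) powr a"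
    and log_gap: "\<forall>\<^sub>F m in at_top. \<forall>x\<in>R m. \<forall>y\<in>R m. x < y \<longrightarrow>
       log 2 (real x) \<le> G * log 2 (real y) powr a"
    and U_subset: "\<forall>\<^sub>F m in at_top. set (U m) \<subseteq> R m \<and> U m \<noteq> []"
begin

lemma eventually_log_large:
  assumes "\<forall>\<^sub>F L in at_top. P L"
  shows "\<forall>\<^sub>F m in at_top. \<forall>x\<in>R m. P (log 2 (real x))"
proof -
  obtain L where L: "\<And>l. L \<le> l \<Longrightarrow> P l" using assms unfolding eventually_at_top_linorder by blast
  have "\<forall>\<^sub>F m::nat in at_top. L \<le> c * log 2 (real m) powr b"
    using filterlim_powr_log constants_pos(1) b(1) by (simp add: filterlim_at_top)
  with log_bounds show ?thesis
    by eventually_elim (meson L order_trans)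
qed

lemma eventually_gap:
  assumes "0 < K"
  shows "\<forall>\<^sub>F m in at_top. \<forall>x\<in>R m. \<forall>y\<in>R m. x < y \<longrightarrow> K * real x \<le> real y"
  using eventually_log_large[OF powr_sublinear[OF a(2), of G "log 2 K"]] log_gap log_bounds
proof eventually_elim
  case (elim m)
  show ?case
  proof (intro ballI impI)
    fix x y assume xy: "x \<in> R m" "y \<in> R m" "x < y"
    then have x: "0 < real x" and y: "0 < real y" using elim(3) by fastforce+
    have "log 2 (K * real x) = log 2 K + log 2 (real x)" using x assms by (simp add: log_mult)
    also have "\<dots> \<le> log 2 (real y)" using elim(1)[rule_format, OF xy(2)] elim(2)[rule_format, OF xy] by linarith
    finally show "K * real x \<le> real y" using x y assms by simp
  qed
qed

lemma theta_growth':
  obtains c' where "0 < c'" "\<forall>\<^sub>F m in at_top. 0 < theta a (U m) j \<and>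
    c' * log 2 (real m) powr (b * a ^ j) \<le> log 2 (real_of_int (theta a (U m) j))"
proof -
  have "\<forall>\<^sub>F m in at_top. 0 < Min (set (U m)) \<and> c * log 2 (real m) powr b \<le> log 2 (real (Min (set (U m))))"
    using log_bounds U_subset
  proof eventually_elim
    case (elim m)
    then have "Min (set (U m)) \<in> R m" by (meson List.finite_set Min_in set_empty subsetD)
    then show ?case using elim(1) by fastforce
  qed
  then show thesis using theta_growth[OF a(1) b(1) constants_pos(1)] that by blast
qed

lemma theta_pos: "\<forall>\<^sub>F m in at_top. 0 < theta a (U m) j"
proof -
  obtain c' where "\<forall>\<^sub>F m in at_top. 0 < theta a (U m) j \<and>
    c' * log 2 (real m) powr (b * a ^ j) \<le> log 2 (real_of_int (theta a (U m) j))"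
    using theta_growth' by blast
  then show ?thesis by eventually_elim blast
qed

lemma log_theta_at_top: "filterlim (\<lambda>m. log 2 (real_of_int (theta a (U m) j))) at_top at_top"
proof -
  obtain c' where c': "0 < c'" "\<forall>\<^sub>F m in at_top. 0 < theta a (U m) j \<and>
    c' * log 2 (real m) powr (b * a ^ j) \<le> log 2 (real_of_int (theta a (U m) j))"
    using theta_growth' by blast
  have "filterlim (\<lambda>m::nat. c' * log 2 (real m) powr (b * a ^ j)) at_top at_top"
    using c'(1) a b by (intro filterlim_powr_log) auto
  then show ?thesis by (rule filterlim_at_top_mono) (use c'(2) in eventually_elim, blast)
qed

lemma theta_at_top: "filterlim (\<lambda>m. theta a (U m) j) at_top at_top"
  unfolding filterlim_at_top
proof
  fix Z :: int
  have "\<forall>\<^sub>F m in at_top. log 2 (real_of_int (\<bar>Z\<bar> + 1)) \<le> log 2 (real_of_int (theta a (U m) j))"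
    using log_theta_at_top by (simp add: filterlim_at_top)
  with theta_pos[of j] show "\<forall>\<^sub>F m in at_top. Z \<le> theta a (U m) j"
  proof eventually_elim
    case (elim m)
    have "real_of_int (\<bar>Z\<bar> + 1) \<le> real_of_int (theta a (U m) j)"
      by (rule log_le_cancel_iff[THEN iffD1, of 2]) (use elim in auto)
    then show ?case by linarith
  qed
qed

text \<open>With \<open>L = log \<theta>\<^sub>j\<close>, sublinearity gives
  \<open>L^a + log K \<le> L\<close> for large \<open>L\<close>, and rounding down only helps. The
  factors 2 and \<open>2^(n+4)\<close> in \<open>separated\<close> are instances.\<close>

lemma theta_ratio:
  fixes K :: int
  assumes "0 < K"
  shows "\<forall>\<^sub>F m in at_top. K * theta a (U m) (Suc j) \<le> theta a (U m) j"
proof -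
  have "\<forall>\<^sub>F m in at_top. 1 * log 2 (real_of_int (theta a (U m) j)) powr a + log 2 (real_of_int K)
      \<le> log 2 (real_of_int (theta a (U m) j))"
    using powr_sublinear[OF a(2)] log_theta_at_top by (rule eventually_compose_filterlim)
  with theta_pos[of j] show ?thesis
  proof eventually_elim
    case (elim m)
    define L where "L = log 2 (real_of_int (theta a (U m) j))"
    have "real_of_int (theta a (U m) (Suc j)) \<le> 2 powr (L powr a)" by (simp add: L_def)
    then have "real_of_int (K * theta a (U m) (Suc j)) \<le> real_of_int K * 2 powr (L powr a)"
      using assms by simp
    also have "\<dots> = 2 powr (L powr a + log 2 (real_of_int K))"
      using assms by (simp add: powr_add)
    also have "\<dots> \<le> 2 powr L" using elim(2) by (intro powr_mono) (auto simp: L_def)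
    also have "\<dots> = real_of_int (theta a (U m) j)" using elim by (simp add: L_def)
    finally show ?case by (simp only: of_int_le_iff)
  qed
qed

lemma eventually_separated: "\<forall>\<^sub>F m in at_top. separated (set (U m)) (theta a (U m)) n"
proof -
  have "\<forall>\<^sub>F m in at_top. \<forall>j\<in>{..Suc n}. 0 < theta a (U m) j"
    using theta_pos by (intro eventually_ball_finite) auto
  moreover have "\<forall>\<^sub>F m in at_top. \<forall>j\<in>{..n}. 2 * theta a (U m) (Suc j) \<le> theta a (U m) j"
    using theta_ratio[of 2] by (intro eventually_ball_finite) auto
  moreover have "\<forall>\<^sub>F m in at_top. 2 ^ (n + 4) * theta a (U m) (Suc 0) \<le> theta a (U m) 0"
    by (rule theta_ratio) simp
  moreover have "\<forall>\<^sub>F m in at_top. \<forall>x\<in>R m. \<forall>y\<in>R m. x < y \<longrightarrow> 4 * real x \<le> real y"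
    by (rule eventually_gap) simp
  ultimately show ?thesis using U_subset
  proof eventually_elim
    case (elim m)
    show ?case
    proof
      show "theta a (U m) 0 \<le> int x" if "x \<in> set (U m)" for x using that by simp
      show "4 * x \<le> y" if "x \<in> set (U m)" "y \<in> set (U m)" "x < y" for x y
      proof -
        have "4 * real x \<le> real y" using that elim by blast
        then show ?thesis by linarith
      qed
    qed (use elim in auto)
  qed
qed

text \<open>Three elements guarantee a second maximum. Both maxima lie in \<open>R m\<close>, so
  plasticity controls them whatever has been deleted before.\<close>

lemma feasible_tracked:
  assumes i: "i \<le> n"
    and ev: "\<forall>\<^sub>F m in at_top. distinct (V m) \<and> set (V m) \<subseteq> set (U m) \<and> 3 \<le> length (V m) \<and>
      (\<exists>X. tracked (theta a (U m)) (V m) i X \<and> A m = signed_array X)"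
  shows "feasible a (b * a ^ i) A"
proof -
  define M N where "M m = int (Max (set (V m)))" and
    "N m = int (Max (set (V m) - {Max (set (V m))}))" for m
  have maxima: "\<forall>\<^sub>F m in at_top. nat (M m) \<in> R m \<and> nat (N m) \<in> R m \<and> N m < M m"
    using ev U_subset
  proof eventually_elim
    case (elim m)
    have "2 \<le> card (set (V m) - {Max (set (V m))})"
      using elim(1) by (auto simp: card_Diff_singleton_if distinct_card)
    then have "set (V m) - {Max (set (V m))} \<noteq> {}" by (metis card.empty not_numeral_le_zero)
    moreover from this have "set (V m) \<noteq> {}" by (metis empty_Diff)
    ultimately have "Max (set (V m) - {Max (set (V m))}) \<in> set (V m) - {Max (set (V m))}" "Max (set (V m)) \<in> set (V m)"
      by (meson List.finite_set Max_in finite_Diff)+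
    then show ?case using elim by (auto simp: M_def N_def order.strict_iff_order)
  qed
  obtain c' where c': "0 < c'" "\<forall>\<^sub>F m in at_top. 0 < theta a (U m) i \<and>
    c' * log 2 (real m) powr (b * a ^ i) \<le> log 2 (real_of_int (theta a (U m) i))"
    using theta_growth' by blast
  have "b * a ^ i \<le> b * 1" using a b by (intro mult_left_mono) (auto simp: power_le_one)
  then have "b * a ^ i < 1" using b by linarith
  moreover have "0 < b * a ^ i" using a b by simp
  ultimately have b': "0 < b * a ^ i" "b * a ^ i < 1" by blast+
  show ?thesis
  proof (rule feasibleI_bounds[OF a b' c'(1) constants_pos(2,3) _ c'(2), where M = M and N = N])
    show "\<forall>\<^sub>F m in at_top. fst (A m) \<noteq> {#} \<and> snd (A m) \<noteq> {#} \<and>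
        is_array (A m) \<and> invariant_array (A m) \<and> distinct_array (A m) \<and>
        M m \<le> 2 * max_pos (A m) \<and> max_pos (A m) \<le> M m \<and>
        \<bar>max_neg (A m) - max_pos (A m)\<bar> \<le> 2 * N m \<and>
        (\<forall>w\<in>Zset (A m). theta a (U m) i \<le> w \<and> w \<le> 2 * N m)"
      using ev eventually_separated[of n]
    proof eventually_elim
      case (elim m)
      interpret separated "set (U m)" "theta a (U m)" n by fact
      obtain X where V: "distinct (V m)" "set (V m) \<subseteq> set (U m)" "3 \<le> length (V m)"
        and X: "tracked (theta a (U m)) (V m) i X" "A m = signed_array X" using elim by blast
      show ?case unfolding X(2) M_def N_def
        using tracked_array[OF V i X(1)] tracked_bounds[OF V i X(1)] by blast
    qed
    show "\<forall>\<^sub>F m in at_top. 0 < N m \<and> 0 < M m \<and>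
        log 2 (real_of_int (N m)) \<le> G * log 2 (real_of_int (M m)) powr a \<and>
        log 2 (real_of_int (M m)) \<le> C * log 2 (real m) powr a"
      using maxima log_bounds log_gap
    proof eventually_elim
      case (elim m)
      have "1 \<le> nat (N m)" "1 \<le> nat (M m)" "log 2 (real (nat (M m))) \<le> C * log 2 (real m) powr a"
        using elim(1,2) by blast+
      moreover have "nat (N m) < nat (M m)" using elim(1) calculation by linarith
      then have "log 2 (real (nat (N m))) \<le> G * log 2 (real (nat (M m))) powr a"
        using elim(1,3) by blast
      moreover have "real (nat (M m)) = real_of_int (M m)" "real (nat (N m)) = real_of_int (N m)"
        by (simp_all add: M_def N_def)
      ultimately show ?case by auto
    qed
    show "filterlim (\<lambda>m. log 2 (real_of_int (M m))) at_top at_top"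
      unfolding filterlim_at_top
    proof
      fix Z :: real
      have "\<forall>\<^sub>F m in at_top. \<forall>x\<in>R m. Z \<le> log 2 (real x)"
        by (rule eventually_log_large) (rule eventually_ge_at_top)
      with maxima show "\<forall>\<^sub>F m in at_top. Z \<le> log 2 (real_of_int (M m))"
      proof eventually_elim
        case (elim m)
        then have "Z \<le> log 2 (real (nat (M m)))" by blast
        then show ?case by (simp add: M_def)
      qed
    qed
  qed
qed

text \<open>The size condition on \<theta> holds with constant 1: \<open>\<theta>\<^sub>i\<close> is
  at most \<open>delta\<close>, and \<open>2^(log^a x)\<close> is increasing. Positivity of
  \<open>B\<close> is a hypothesis here; it is supplied by the tracking of the next stage.\<close>

lemma ancestor_tracked:
  assumes i: "i < n"
    and ev: "\<forall>\<^sub>F m in at_top. distinct (V m) \<and> set (V m) \<subseteq> set (U m) \<and> 3 \<le> length (V m) \<and>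
      (\<exists>X. tracked (theta a (U m)) (V m) i X \<and> A m = signed_array X)"
    and nm: "\<forall>\<^sub>F m in at_top. \<not> monotonic (V m)"
    and B: "\<And>m. B m = anc_array ty (theta a (U m) (Suc i)) (A m)"
      "\<forall>\<^sub>F m in at_top. is_array (B m)"
  shows "ancestor a ty (\<lambda>m. theta a (U m) (Suc i)) A B"
  unfolding ancestor_def
proof (intro conjI)
  have "i \<le> n" using i by simp
  then show "\<exists>b'. feasible a b' A" using feasible_tracked ev by blast
  show "filterlim (\<lambda>m. theta a (U m) (Suc i)) at_top at_top" by (rule theta_at_top)
  show "\<forall>\<^sub>F m in at_top. B m = anc_array ty (theta a (U m) (Suc i)) (A m) \<and> is_array (B m)"
    using B by simp
  show "\<forall>\<^sub>F m in at_top. 2 \<le> size (fst (A m)) \<and> 2 \<le> size (snd (A m))"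
    using ev nm eventually_separated[of n]
  proof eventually_elim
    case (elim m)
    interpret separated "set (U m)" "theta a (U m)" n by fact
    obtain X where V: "distinct (V m)" "set (V m) \<subseteq> set (U m)" "3 \<le> length (V m)"
      and X: "tracked (theta a (U m)) (V m) i X" "A m = signed_array X" using elim by blast
    show ?case using tracked_sizes[OF V \<open>i \<le> n\<close> X(1)] non_monotonic_sizes(1,2)[OF V(1)] elim(2) X(2)
      by auto
  qed
  show "(\<lambda>m. real_of_int (theta a (U m) (Suc i))) \<in> O(\<lambda>m. 2 powr (log 2 (real_of_int (delta (A m))) powr a))"
  proof (rule bigoI[where c = 1])
    have "\<forall>\<^sub>F m in at_top. 0 \<le> log 2 (real_of_int (theta a (U m) i))"
      using log_theta_at_top by (simp add: filterlim_at_top)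
    then show "\<forall>\<^sub>F m in at_top. norm (real_of_int (theta a (U m) (Suc i)))
        \<le> 1 * norm (2 powr (log 2 (real_of_int (delta (A m))) powr a) :: real)"
      using ev eventually_separated[of n] theta_pos[of i] theta_pos[of "Suc i"]
    proof eventually_elim
      case (elim m)
      interpret separated "set (U m)" "theta a (U m)" n by fact
      obtain X where V: "distinct (V m)" "set (V m) \<subseteq> set (U m)" "3 \<le> length (V m)"
        and X: "tracked (theta a (U m)) (V m) i X" "A m = signed_array X" using elim by blast
      have \<delta>: "theta a (U m) i \<le> delta (A m)" using tracked_array(4)[OF V \<open>i \<le> n\<close> X(1)] X(2) by simp
      have "real_of_int (theta a (U m) (Suc i)) \<le> 2 powr (log 2 (real_of_int (theta a (U m) i)) powr a)"
        by simp
      also have "log 2 (real_of_int (theta a (U m) i)) \<le> log 2 (real_of_int (delta (A m)))"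
        using \<delta> elim(4) by (intro log_mono) auto
      then have "2 powr (log 2 (real_of_int (theta a (U m) i)) powr a)
          \<le> (2::real) powr (log 2 (real_of_int (delta (A m))) powr a)"
        using elim(1) a(1) by (intro powr_mono powr_mono2) auto
      finally show ?case using elim(5) by (simp del: theta.simps)
    qed
  qed
qed

end

section \<open>The string of arrays for a prescribed choice of types\<close>

theorem theorem7:
  fixes t k \<tau> :: nat and a b :: real
    and R :: "nat \<Rightarrow> nat set" and U :: "nat \<Rightarrow> nat list"
  assumes "0 < b" and "b \<le> a ^ t" and "a ^ t < 1"
    and "plastic a b t R"
    and "3 < k"
    and "\<forall>\<^sub>F m in at_top. perm_seq k (R m) (U m) \<and> \<not> monotonic (U m)"
    and "\<forall>\<^sub>F m in at_top. tau (U m) = \<tau>"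
  shows "\<forall>ty :: nat \<Rightarrow> anc_type. \<exists>A :: nat \<Rightarrow> nat \<Rightarrow> arr.
    A 0 = (\<lambda>m. seq_array (U m)) \<and>
    (\<forall>i\<in>{1..\<tau>}.
       ancestor a (ty i) (\<lambda>m. theta a (U m) i) (A (i - 1)) (A i) \<and>
       (\<forall>\<^sub>F m in at_top. \<forall>j\<in>{1..i}. theta a (U m) j \<in># entries (A i m)) \<and>
       approx_arrays (\<lambda>m. theta a (U m) 1)
         (\<lambda>m. fold remove_coeff (map (theta a (U m)) [1..<Suc i]) (A i m))
         (\<lambda>m. seq_array ((del_max ^^ i) (U m))) \<and>
       feasible a (b * a ^ i) (A i))"
proof
  fix ty :: "nat \<Rightarrow> anc_type"
  have a0: "0 < a" using plastic_exponent_pos assms(1,2,4) by fastforce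
  have a1: "a < 1" using assms(3) one_le_power[of a t] by fastforce
  obtain c C where cC: "0 < c" "0 < C" "\<forall>\<^sub>F m in at_top. \<forall>x\<in>R m. 1 \<le> x \<and>
       c * log 2 (real m) powr b \<le> log 2 (real x) \<and> log 2 (real x) \<le> C * log 2 (real m) powr a"
    by (rule plastic_log_bounds[OF assms(4)])
  obtain G where G: "0 < G" "\<forall>\<^sub>F m in at_top. \<forall>x\<in>R m. \<forall>y\<in>R m. x < y \<longrightarrow>
       log 2 (real x) \<le> G * log 2 (real y) powr a"
    by (rule plastic_log_gap[OF assms(4) less_imp_le[OF a0]])
  have U: "\<forall>\<^sub>F m in at_top. set (U m) \<subseteq> R m \<and> U m \<noteq> []"
    using assms(6) by eventually_elim (use assms(5) in \<open>auto simp: perm_seq_def\<close>)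
  interpret plastic_family a b c C G R U
    using a0 a1 assms(1-3) cC G U by unfold_locales auto
  \<comment> \<open>The recursion is run for every \<open>m\<close> and every index; its properties
    are established for large \<open>m\<close> and up to \<open>\<tau>\<close>.\<close>
  define A where "A = rec_nat (\<lambda>m. seq_array (U m))
    (\<lambda>j B m. anc_array (ty (Suc j)) (theta a (U m) (Suc j)) (B m))"
  have A0: "A 0 = (\<lambda>m. seq_array (U m))"
    and AS: "A (Suc j) m = anc_array (ty (Suc j)) (theta a (U m) (Suc j)) (A j m)" for j m
    by (simp_all add: A_def)
  have nm: "\<forall>\<^sub>F m in at_top. \<forall>j<\<tau>. \<not> monotonic ((del_max ^^ j) (U m))"
    using assms(7) by eventually_elim (auto simp: tau_def dest: not_less_Least)
  have tr: "\<forall>\<^sub>F m in at_top. distinct ((del_max ^^ i) (U m)) \<and> set ((del_max ^^ i) (U m)) \<subseteq> set (U m) \<and>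
      3 \<le> length ((del_max ^^ i) (U m)) \<and>
      (\<exists>X. tracked (theta a (U m)) ((del_max ^^ i) (U m)) i X \<and> A i m = signed_array X)"
    if "i \<le> \<tau>" for i
    using assms(6) nm U eventually_separated[of \<tau>]
  proof eventually_elim
    case (elim m)
    interpret separated "set (U m)" "theta a (U m)" \<tau> by fact
    \<comment> \<open>The type \<open>ty (Suc j)\<close> leads from \<open>A j\<close> to
      \<open>A (Suc j)\<close>, whereas \<open>tracked_iterate\<close> indexes types by the array
      they start from; hence the shift.\<close>
    show ?case
      by (rule tracked_iterate[where A = "\<lambda>j. A j m" and ty = "\<lambda>j. ty (Suc j)"])
        (use elim assms(5) A0 AS that in \<open>auto simp: perm_seq_def simp del: theta.simps\<close>)
  qed
  have main: "is_array (A i m) \<and> (\<forall>j\<in>{1..i}. theta a (U m) j \<in># entries (A i m)) \<and>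
      rel_mset (\<lambda>x y. real_of_int \<bar>x - y\<bar> \<le> 2 ^ i * real_of_int (theta a (U m) 1))
        (fst (fold remove_coeff (map (theta a (U m)) [1..<Suc i]) (A i m)))
        (fst (seq_array ((del_max ^^ i) (U m)))) \<and>
      rel_mset (\<lambda>x y. real_of_int \<bar>x - y\<bar> \<le> 2 ^ i * real_of_int (theta a (U m) 1))
        (snd (fold remove_coeff (map (theta a (U m)) [1..<Suc i]) (A i m)))
        (snd (seq_array ((del_max ^^ i) (U m))))"
    if "separated (set (U m)) (theta a (U m)) \<tau>" and i: "i \<le> \<tau>" and
      tr': "distinct ((del_max ^^ i) (U m)) \<and> set ((del_max ^^ i) (U m)) \<subseteq> set (U m) \<and>
      3 \<le> length ((del_max ^^ i) (U m)) \<and>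
      (\<exists>X. tracked (theta a (U m)) ((del_max ^^ i) (U m)) i X \<and> A i m = signed_array X)" for i m
  proof -
    interpret separated "set (U m)" "theta a (U m)" \<tau> by fact
    obtain X where V: "distinct ((del_max ^^ i) (U m))" "set ((del_max ^^ i) (U m)) \<subseteq> set (U m)"
      "3 \<le> length ((del_max ^^ i) (U m))"
      and X: "tracked (theta a (U m)) ((del_max ^^ i) (U m)) i X" "A i m = signed_array X"
      using tr' by blast
    show ?thesis unfolding X(2)
      using tracked_array(1)[OF V i X(1)] theta_in_tracked[OF V i X(1)] tracked_approx[OF V i X(1)]
      by auto
  qed
  show "\<exists>A :: nat \<Rightarrow> nat \<Rightarrow> arr.
    A 0 = (\<lambda>m. seq_array (U m)) \<and>
    (\<forall>i\<in>{1..\<tau>}.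
       ancestor a (ty i) (\<lambda>m. theta a (U m) i) (A (i - 1)) (A i) \<and>
       (\<forall>\<^sub>F m in at_top. \<forall>j\<in>{1..i}. theta a (U m) j \<in># entries (A i m)) \<and>
       approx_arrays (\<lambda>m. theta a (U m) 1)
         (\<lambda>m. fold remove_coeff (map (theta a (U m)) [1..<Suc i]) (A i m))
         (\<lambda>m. seq_array ((del_max ^^ i) (U m))) \<and>
       feasible a (b * a ^ i) (A i))"
  proof (intro exI[of _ A] conjI ballI)
    show "A 0 = (\<lambda>m. seq_array (U m))" by (rule A0)
    fix i assume "i \<in> {1..\<tau>}"
    then obtain j where i: "i = Suc j" "j < \<tau>" "i \<le> \<tau>" by (cases i) auto
    note ev = eventually_conj[OF eventually_separated[of \<tau>] tr[OF i(3)]]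
    show "feasible a (b * a ^ i) (A i)" by (rule feasible_tracked[OF i(3) tr[OF i(3)]])
    show "\<forall>\<^sub>F m in at_top. \<forall>j\<in>{1..i}. theta a (U m) j \<in># entries (A i m)"
      using ev by eventually_elim (use main i(3) in blast)
    \<comment> \<open>The constant is \<open>2^i\<close>, which depends on \<open>i\<close> but not
      on \<open>m\<close>.\<close>
    show "approx_arrays (\<lambda>m. theta a (U m) 1)
         (\<lambda>m. fold remove_coeff (map (theta a (U m)) [1..<Suc i]) (A i m))
         (\<lambda>m. seq_array ((del_max ^^ i) (U m)))"
      unfolding approx_arrays_def
      by (rule exI[of _ "2 ^ i"], use ev in eventually_elim, use main i(3) in blast)
    have "\<forall>\<^sub>F m in at_top. \<not> monotonic ((del_max ^^ j) (U m))"
      using nm by eventually_elim (use i(2) in blast)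
    moreover have "\<forall>\<^sub>F m in at_top. is_array (A i m)"
      using ev by eventually_elim (use main i(3) in blast)
    ultimately have "ancestor a (ty (Suc j)) (\<lambda>m. theta a (U m) (Suc j)) (A j) (A (Suc j))"
      using ancestor_tracked[OF i(2) tr[of j], of "A (Suc j)" "ty (Suc j)"] i AS by simp
    then show "ancestor a (ty i) (\<lambda>m. theta a (U m) i) (A (i - 1)) (A i)" by (simp add: i)
  qed
qed

end
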